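(* Let $\mathbf{\Phi}$ be an irreducible and positive recurrent discrete-time Markov chain on a countable state space $E$ with transition matrix $P$ and invariant probability vector $\boldsymbol\pi$, let $A$ be a finite non-empty subset of $E$, and let $B=E\setminus A$. Then the matrix $\widetilde{X}=\begin{bmatrix}\widetilde X_A\\ \widetilde X_B\end{bmatrix}$ given by $$\widetilde{X}_{A}=\left(I-P^{(A)}\right)^{\#}\left(\left[I,\; P_{AB}\widehat{P}_{BB}\right]-\left(\boldsymbol e+P_{AB}\widehat{P}_{BB}\boldsymbol e\right)\boldsymbol\pi^T\right)$$ and $$\widetilde{X}_{B}=\widehat{P}_{BB}P_{BA}\widetilde{X}_A+\left[O,\;\widehat{P}_{BB}\right]-\widehat{P}_{BB}\boldsymbol e\,\boldsymbol \pi^T$$ is a solution of Poisson's equation $$(I-P)X=I-\boldsymbol{e}\boldsymbol{\pi}^T.$$ Moreover, if $\mathbb{E}_{\boldsymbol\pi}[\tau_i]<\infty$ for some $i\in E$, then $\widetilde{X}$ satisfies $\boldsymbol\pi^T|\widetilde X|<\infty$ and is the unique solution of this Poisson's equation, up to adding a matrix of the form $\boldsymbol{e}\boldsymbol{\beta}^T$ with $\boldsymbol\beta$ a constant vector, in the set of matrices $X$ such that $\boldsymbol{\pi}^T|X|<\infty$; that is, every solution $X$ with $\boldsymbol\pi^T|X|<\infty$ is of the form $X=\widetilde X+\boldsymbol e\boldsymbol\beta^T$ for some constant vector $\boldsymbol\beta$.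
   Context: $\mathbf{\Phi}=\{\Phi_k,k\ge 0\}$ is a discrete-time Markov chain on $E$ with transition matrix $P=(P(i,j))_{i,j\in E}$; $\boldsymbol\pi$ is its unique invariant probability vector ($\boldsymbol\pi^TP=\boldsymbol\pi^T$, $\boldsymbol\pi^T\boldsymbol e=1$). $\boldsymbol e$ is the column vector of ones, $I$ the identity matrix, $O$ the zero matrix, each of the size appropriate to the place where it occurs. $P_{A_1A_2}=(P(i,j))_{i\in A_1,j\in A_2}$ denotes blocks of $P$. Matrices $X=(X(i,j))_{i,j\in E}$ are real; $X_A$ and $X_B$ denote the rows of $X$ indexed by $A$ and by $B$ respectively (with all columns in $E$); in a bracket $[\,\cdot\,,\,\cdot\,]$ the first block consists of the columns indexed by $A$ and the second of the columns indexed by $B$. $|X|$ is the entrywise absolute value, and $\boldsymbol\pi^T|X|<\infty$ means that $\sum_{i\in E}\pi(i)|X(i,n)|<\infty$ for every $n\in E$. $\widehat P_{BB}:=\sum_{k=0}^\infty P_{BB}^k$ (finite entrywise), and $P^{(A)}:=P_{AA}+P_{AB}\widehat P_{BB}P_{BA}$ is the transition matrix of the Markov chain censored on $A$. The group inverse $W^{\#}$ of a finite square matrix $W$ is the unique matrix with $WW^{\#}W=W$, $W^{\#}WW^{\#}=W^{\#}$, $W^{\#}W=WW^{\#}$. $\tau_i:=\inf\{k\ge 1:\Phi_k=i\}$ is the first return time to $i$, and $\mathbb E_{\boldsymbol\pi}$ denotes expectation when $\Phi_0$ has distribution $\boldsymbol\pi$. *)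

theory Defs
  imports "HOL-Probability.Probability"
begin

text \<open>
  The state space is the type \<open>'s :: countable\<close> (finite or countably infinite). A stochastic
  matrix is given by its rows, \<open>K :: 's \<Rightarrow> 's pmf\<close>, and a probability vector by a \<open>'s pmf\<close>.
\<close>

section \<open>The Markov chain\<close>

text \<open>
  \<open>chain_law K \<mu>\<close> is the law, on the path space \<open>nat \<Rightarrow> 's\<close>, of the Markov chain with transition
  matrix \<open>K\<close> and initial distribution \<open>\<mu>\<close>; the chain itself is the coordinate process
  \<open>\<Phi>\<^sub>k \<omega> = \<omega> k\<close>. It is obtained from the Ionescu-Tulcea theorem; \<open>emeasure_chain_law\<close> below gives its
  finite-dimensional distributions.
\<close>

definition chain_step :: "('s \<Rightarrow> 's pmf) \<Rightarrow> 's pmf \<Rightarrow> nat \<Rightarrow> (nat \<Rightarrow> 's) \<Rightarrow> 's measure" where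
  "chain_step K \<mu> n \<omega> = (case n of 0 \<Rightarrow> measure_pmf \<mu> | Suc m \<Rightarrow> measure_pmf (K (\<omega> m)))"

definition chain_law :: "('s::countable \<Rightarrow> 's pmf) \<Rightarrow> 's pmf \<Rightarrow> (nat \<Rightarrow> 's) measure" where
  "chain_law K \<mu> = projective_family.lim UNIV
     (Ionescu_Tulcea.CI (chain_step K \<mu>) (\<lambda>_. count_space UNIV)) (\<lambda>_. count_space UNIV)"

lemma Ionescu_Tulcea_chain_step:
  "Ionescu_Tulcea (chain_step K (\<mu> :: 's::countable pmf)) (\<lambda>_. count_space UNIV)"
proof (rule Ionescu_Tulcea.intro)
  fix n
  show "chain_step K \<mu> n \<in> measurable (PiM {0..<n} (\<lambda>_. count_space UNIV))
      (subprob_algebra (count_space UNIV))"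
  proof (cases n)
    case 0
    then have "chain_step K \<mu> n = (\<lambda>_. measure_pmf \<mu>)"
      by (simp add: chain_step_def fun_eq_iff)
    then show ?thesis
      by (simp add: measure_pmf_in_subprob_algebra)
  next
    case (Suc m)
    have "(\<lambda>\<omega>. \<omega> m) \<in> measurable (PiM {0..<n} (\<lambda>_. count_space (UNIV::'s set))) (count_space UNIV)"
      using Suc by (intro measurable_component_singleton) auto
    moreover have "(\<lambda>x. measure_pmf (K x)) \<in> measurable (count_space UNIV) (subprob_algebra (count_space UNIV))"
      by (simp add: measure_pmf_in_subprob_algebra)
    ultimately have "(\<lambda>\<omega>. measure_pmf (K (\<omega> m))) \<in>
        measurable (PiM {0..<n} (\<lambda>_. count_space (UNIV::'s set))) (subprob_algebra (count_space UNIV))"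
      by (rule measurable_compose)
    then show ?thesis
      using Suc by (simp add: chain_step_def[abs_def])
  qed
next
  fix n x
  show "prob_space (chain_step K \<mu> n x)"
    by (simp add: chain_step_def prob_space_measure_pmf split: nat.split)
qed

context
  fixes K :: "'s::countable \<Rightarrow> 's pmf" and \<mu> :: "'s pmf"
begin

interpretation IT: Ionescu_Tulcea "chain_step K \<mu>" "\<lambda>_. count_space UNIV"
  by (rule Ionescu_Tulcea_chain_step)

lemma sets_chain_law [measurable_cong]:
  "sets (chain_law K \<mu>) = sets (PiM UNIV (\<lambda>_. count_space UNIV))"
  by (simp add: chain_law_def)

lemma space_chain_law [simp]: "space (chain_law K \<mu>) = UNIV"
  by (simp add: chain_law_def space_PiM)

lemma prob_space_chain_law: "prob_space (chain_law K \<mu>)"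
proof (rule prob_spaceI)
  have "emeasure (chain_law K \<mu>) (prod_emb UNIV (\<lambda>_. count_space UNIV) {} {\<lambda>_. undefined}) =
      emeasure (IT.CI {}) {\<lambda>_. undefined}"
    unfolding chain_law_def by (rule IT.lim) (auto simp: PiM_empty)
  also have "\<dots> = 1"
    using prob_space.emeasure_space_1[OF IT.PF.prob_space_P[of "{}"]]
    by (simp add: IT.PF.space_P space_PiM)
  finally show "emeasure (chain_law K \<mu>) (space (chain_law K \<mu>)) = 1"
    by (simp add: prod_emb_def space_PiM restrict_def)
qed

lemma emeasure_chain_law:
  "emeasure (chain_law K \<mu>) {\<omega>. \<forall>k\<le>n. \<omega> k = x k}
     = ennreal (pmf \<mu> (x 0) * (\<Prod>k<n. pmf (K (x k)) (x (Suc k))))"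
proof -
  let ?M = "\<lambda>_::nat. count_space (UNIV :: 's set)"
  let ?u = "\<lambda>_::nat. undefined :: 's"
  let ?E = "\<lambda>n. {restrict x {0..<n}}"
  have sets_E [measurable]: "?E n \<in> sets (PiM {0..<n} ?M)" for n
  proof -
    have "?E n = PiE {0..<n} (\<lambda>k. {x k})"
      by (auto simp: PiE_iff extensional_def fun_eq_iff restrict_def)
    also have "\<dots> \<in> sets (PiM {0..<n} ?M)"
      by (intro sets_PiM_I_finite) auto
    finally show ?thesis .
  qed
  have u: "?u \<in> space (PiM {0..<0} ?M)"
    by (simp add: space_PiM)
  have step: "emeasure (IT.C 0 (Suc n) ?u) (?E (Suc n))
      = emeasure (IT.C 0 n ?u) (?E n) * emeasure (chain_step K \<mu> n x) {x n}" for n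
  proof -
    have sets_C: "sets (IT.C 0 n ?u) = sets (PiM {0..<n} ?M)"
      using IT.sets_C[OF u, of n] by simp
    have space_C: "space (IT.C 0 n ?u) = space (PiM {0..<n} ?M)"
      using IT.space_C[OF u, of n] by simp
    have kernel: "emeasure (IT.eP n \<omega>) (?E (Suc n))
        = emeasure (chain_step K \<mu> n x) {x n} * indicator (?E n) \<omega>"
      if \<omega>: "\<omega> \<in> space (PiM {0..<n} ?M)" for \<omega>
    proof (cases "\<omega> = restrict x {0..<n}")
      case True
      have *: "(\<lambda>y. fun_upd \<omega> n y) -` ?E (Suc n) = {x n}"
      proof (intro set_eqI iffI)
        fix y assume "y \<in> (\<lambda>y. fun_upd \<omega> n y) -` ?E (Suc n)"
        then have "fun_upd \<omega> n y n = restrict x {0..<Suc n} n"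
          by simp
        then show "y \<in> {x n}"
          by simp
      qed (auto simp: True fun_eq_iff restrict_def)
      have **: "chain_step K \<mu> n \<omega> = chain_step K \<mu> n x"
        by (simp add: chain_step_def True split: nat.split)
      show ?thesis
        using IT.emeasure_eP[OF \<omega> sets_E[of "Suc n"]] * ** by (simp add: True)
    next
      case False
      have "fun_upd \<omega> n y \<noteq> restrict x {0..<Suc n}" for y
      proof
        assume eq: "fun_upd \<omega> n y = restrict x {0..<Suc n}"
        have "\<omega> k = restrict x {0..<n} k" for k
          using fun_cong[OF eq, of k] \<omega>
          by (cases "k = n"; cases "k < n") (auto simp: space_PiM PiE_def extensional_def)
        with False show False by blast
      qed
      then have *: "(\<lambda>y. fun_upd \<omega> n y) -` ?E (Suc n) = {}"
        by auto
      show ?thesis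
        using IT.emeasure_eP[OF \<omega> sets_E[of "Suc n"]] * False by simp
    qed
    have eP: "IT.eP n \<in> measurable (IT.C 0 n ?u) (subprob_algebra (PiM {0..<Suc n} ?M))"
      using IT.measurable_eP[of n] by (simp add: measurable_cong_sets[OF sets_C refl])
    have ne: "space (IT.C 0 n ?u) \<noteq> {}"
      using IT.prob_space_C[OF u, of n] by (rule prob_space.not_empty)
    have "emeasure (IT.C 0 (Suc n) ?u) (?E (Suc n))
        = (\<integral>\<^sup>+ \<omega>. emeasure (IT.eP n \<omega>) (?E (Suc n)) \<partial>IT.C 0 n ?u)"
      using emeasure_bind[OF ne eP sets_E] by simp
    also have "\<dots> = (\<integral>\<^sup>+ \<omega>. emeasure (chain_step K \<mu> n x) {x n} * indicator (?E n) \<omega> \<partial>IT.C 0 n ?u)"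
      by (intro nn_integral_cong kernel) (simp add: space_C)
    also have "\<dots> = emeasure (chain_step K \<mu> n x) {x n} * emeasure (IT.C 0 n ?u) (?E n)"
      by (rule nn_integral_cmult_indicator) (simp only: sets_C sets_E)
    finally show ?thesis
      by (simp add: mult.commute)
  qed
  have start: "emeasure (IT.C 0 0 ?u) (?E 0) = 1"
    using sets_E[of 0] by (simp add: restrict_def)
  have path: "emeasure (IT.C 0 (Suc n) ?u) (?E (Suc n))
      = ennreal (pmf \<mu> (x 0) * (\<Prod>k<n. pmf (K (x k)) (x (Suc k))))"
  proof (induction n)
    case 0
    show ?case
      unfolding step[of 0] start by (simp add: chain_step_def emeasure_pmf_single)
  next
    case (Suc n)
    show ?case
      unfolding step[of "Suc n"] Suc.IH
      by (simp add: chain_step_def emeasure_pmf_single ennreal_mult''[symmetric] mult.assoc)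
  qed
  have "{\<omega>. \<forall>k\<le>n. \<omega> k = x k} = prod_emb UNIV ?M {0..<Suc n} (?E (Suc n))"
  proof -
    have "restrict \<omega> {0..<Suc n} = restrict x {0..<Suc n} \<longleftrightarrow> (\<forall>k\<le>n. \<omega> k = x k)" for \<omega>
    proof
      assume eq: "restrict \<omega> {0..<Suc n} = restrict x {0..<Suc n}"
      show "\<forall>k\<le>n. \<omega> k = x k"
      proof (intro allI impI)
        fix k assume "k \<le> n"
        then show "\<omega> k = x k"
          using fun_cong[OF eq, of k] by simp
      qed
    qed (auto simp: restrict_def)
    then show ?thesis
      by (auto simp: prod_emb_def space_PiM simp del: atLeastLessThanSuc)
  qed
  then have "emeasure (chain_law K \<mu>) {\<omega>. \<forall>k\<le>n. \<omega> k = x k} = emeasure (IT.CI {0..<Suc n}) (?E (Suc n))"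
    unfolding chain_law_def using IT.lim[OF _ sets_E[of "Suc n"]] by simp
  also have "\<dots> = emeasure (IT.C 0 (Suc n) ?u) (?E (Suc n))"
    using IT.emeasure_CI[OF subset_refl sets_E[of "Suc n"]] sets.sets_into_space[OF sets_E[of "Suc n"]]
    by (simp add: prod_emb_id space_PiM)
  finally show ?thesis
    using path by simp
qed

end

text \<open>First return time; \<open>\<infinity>\<close> if the state is never visited at a time \<open>k \<ge> 1\<close>.\<close>

definition return_time :: "'s \<Rightarrow> (nat \<Rightarrow> 's) \<Rightarrow> ennreal" where
  "return_time i \<omega> = (INF k\<in>{k. 1 \<le> k \<and> \<omega> k = i}. of_nat k)"

definition expected_return_time :: "('s::countable \<Rightarrow> 's pmf) \<Rightarrow> 's pmf \<Rightarrow> 's \<Rightarrow> ennreal" where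
  "expected_return_time K \<mu> i = (\<integral>\<^sup>+ \<omega>. return_time i \<omega> \<partial>chain_law K \<mu>)"

section \<open>Matrices indexed by sets of states\<close>

text \<open>
  A matrix or block is a function \<open>'s \<Rightarrow> 's \<Rightarrow> real\<close> of which only the entries in the relevant rows
  and columns matter; the product \<open>X \<cdot>\<^bsub>S\<^esub> Y\<close> sums over the common index set \<open>S\<close>.
\<close>

definition mat_mult :: "('s \<Rightarrow> 's \<Rightarrow> real) \<Rightarrow> 's set \<Rightarrow> ('s \<Rightarrow> 's \<Rightarrow> real) \<Rightarrow> 's \<Rightarrow> 's \<Rightarrow> real"
    ("(_ \<cdot>\<^bsub>_\<^esub> _)" [70, 0, 71] 70) where
  "(X \<cdot>\<^bsub>S\<^esub> Y) i j = (\<Sum>\<^sub>\<infinity>k\<in>S. X i k * Y k j)"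

definition mat_vec :: "('s \<Rightarrow> 's \<Rightarrow> real) \<Rightarrow> 's set \<Rightarrow> ('s \<Rightarrow> real) \<Rightarrow> 's \<Rightarrow> real" where
  "mat_vec X S v i = (\<Sum>\<^sub>\<infinity>k\<in>S. X i k * v k)"

definition ident :: "'s \<Rightarrow> 's \<Rightarrow> real" where
  "ident i j = (if i = j then 1 else 0)"

definition ones :: "'s \<Rightarrow> real" where
  "ones i = 1"

primrec mat_pow :: "'s set \<Rightarrow> ('s \<Rightarrow> 's \<Rightarrow> real) \<Rightarrow> nat \<Rightarrow> 's \<Rightarrow> 's \<Rightarrow> real" where
  "mat_pow S X 0 = ident"
| "mat_pow S X (Suc n) = mat_pow S X n \<cdot>\<^bsub>S\<^esub> X"

text \<open>Entries outside \<open>A \<times> A\<close> are set to \<open>0\<close> so that the group inverse is unique as a function.\<close>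

definition is_group_inverse :: "'s set \<Rightarrow> ('s \<Rightarrow> 's \<Rightarrow> real) \<Rightarrow> ('s \<Rightarrow> 's \<Rightarrow> real) \<Rightarrow> bool" where
  "is_group_inverse A W G \<longleftrightarrow>
     (\<forall>i\<in>A. \<forall>j\<in>A. (W \<cdot>\<^bsub>A\<^esub> G \<cdot>\<^bsub>A\<^esub> W) i j = W i j) \<and>
     (\<forall>i\<in>A. \<forall>j\<in>A. (G \<cdot>\<^bsub>A\<^esub> W \<cdot>\<^bsub>A\<^esub> G) i j = G i j) \<and>
     (\<forall>i\<in>A. \<forall>j\<in>A. (G \<cdot>\<^bsub>A\<^esub> W) i j = (W \<cdot>\<^bsub>A\<^esub> G) i j) \<and>
     (\<forall>i j. i \<notin> A \<or> j \<notin> A \<longrightarrow> G i j = 0)"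

definition group_inverse :: "'s set \<Rightarrow> ('s \<Rightarrow> 's \<Rightarrow> real) \<Rightarrow> 's \<Rightarrow> 's \<Rightarrow> real" where
  "group_inverse A W = (THE G. is_group_inverse A W G)"

section \<open>Irreducibility, positive recurrence, invariance\<close>

definition tmat :: "('s \<Rightarrow> 's pmf) \<Rightarrow> 's \<Rightarrow> 's \<Rightarrow> real" where
  "tmat K i j = pmf (K i) j"

definition irreducible_chain :: "('s \<Rightarrow> 's pmf) \<Rightarrow> bool" where
  "irreducible_chain K \<longleftrightarrow> (\<forall>i j. \<exists>n. mat_pow UNIV (tmat K) n i j > 0)"

definition positive_recurrent :: "('s::countable \<Rightarrow> 's pmf) \<Rightarrow> bool" where
  "positive_recurrent K \<longleftrightarrow> (\<forall>i. expected_return_time K (return_pmf i) i < \<infinity>)"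

definition invariant_pmf :: "('s \<Rightarrow> 's pmf) \<Rightarrow> 's pmf \<Rightarrow> bool" where
  "invariant_pmf K \<pi> \<longleftrightarrow> (\<forall>j. ((\<lambda>i. pmf \<pi> i * tmat K i j) has_sum pmf \<pi> j) UNIV)"

section \<open>Poisson's equation\<close>

text \<open>\<open>has_sum\<close> over the reals is absolute, so being a solution includes that \<open>(I - P) X\<close> exists.\<close>

definition poisson_solution :: "('s \<Rightarrow> 's pmf) \<Rightarrow> 's pmf \<Rightarrow> ('s \<Rightarrow> 's \<Rightarrow> real) \<Rightarrow> bool" where
  "poisson_solution K \<pi> X \<longleftrightarrow>
     (\<forall>i n. ((\<lambda>k. (ident i k - tmat K i k) * X k n) has_sum (ident i n - ones i * pmf \<pi> n)) UNIV)"

definition pi_abs_finite :: "'s pmf \<Rightarrow> ('s \<Rightarrow> 's \<Rightarrow> real) \<Rightarrow> bool" where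
  "pi_abs_finite \<pi> X \<longleftrightarrow> (\<forall>n. (\<lambda>i. pmf \<pi> i * \<bar>X i n\<bar>) summable_on UNIV)"

definition hat_P :: "('s \<Rightarrow> 's pmf) \<Rightarrow> 's set \<Rightarrow> 's \<Rightarrow> 's \<Rightarrow> real" where
  "hat_P K B i j = (\<Sum>k. mat_pow B (tmat K) k i j)"

definition censored :: "('s \<Rightarrow> 's pmf) \<Rightarrow> 's set \<Rightarrow> 's \<Rightarrow> 's \<Rightarrow> real" where
  "censored K A i j = tmat K i j + (tmat K \<cdot>\<^bsub>- A\<^esub> hat_P K (- A) \<cdot>\<^bsub>- A\<^esub> tmat K) i j"

text \<open>
  The rows of the solution indexed by \<open>A\<close> and by \<open>B = - A\<close>; the column blocks \<open>[I, P\<^sub>A\<^sub>B H]\<close> and \<open>[O, H]\<close>,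
  where \<open>H = hat_P K B\<close>, become a case distinction on the column \<open>n\<close>.
\<close>

definition X_A :: "('s \<Rightarrow> 's pmf) \<Rightarrow> 's pmf \<Rightarrow> 's set \<Rightarrow> 's \<Rightarrow> 's \<Rightarrow> real" where
  "X_A K \<pi> A = (let B = - A; P = tmat K; H = hat_P K B in
     group_inverse A (\<lambda>i j. ident i j - censored K A i j) \<cdot>\<^bsub>A\<^esub>
       (\<lambda>i n. (if n \<in> A then ident i n else (P \<cdot>\<^bsub>B\<^esub> H) i n)
              - (ones i + mat_vec (P \<cdot>\<^bsub>B\<^esub> H) B ones i) * pmf \<pi> n))"

definition X_B :: "('s \<Rightarrow> 's pmf) \<Rightarrow> 's pmf \<Rightarrow> 's set \<Rightarrow> 's \<Rightarrow> 's \<Rightarrow> real" where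
  "X_B K \<pi> A = (let B = - A; P = tmat K; H = hat_P K B in
     (\<lambda>i n. (H \<cdot>\<^bsub>B\<^esub> P \<cdot>\<^bsub>A\<^esub> X_A K \<pi> A) i n
            + (if n \<in> A then 0 else H i n)
            - mat_vec H B ones i * pmf \<pi> n))"

definition X_tilde :: "('s \<Rightarrow> 's pmf) \<Rightarrow> 's pmf \<Rightarrow> 's set \<Rightarrow> 's \<Rightarrow> 's \<Rightarrow> real" where
  "X_tilde K \<pi> A i n = (if i \<in> A then X_A K \<pi> A i n else X_B K \<pi> A i n)"

end

theory Submission
  imports Defs
begin

text \<open>
  Write \<open>B = - A\<close>. Let \<open>T f i = E\<^sub>i[f(\<Phi>\<^sub>1); \<Phi>\<^sub>1 \<in> B]\<close> be the transition operator killed on \<open>A\<close> and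
  \<open>V f = \<Sum>\<^sub>n T\<^sup>n f\<close> its Green operator, so that \<open>V f i\<close> is the expected sum of \<open>f\<close> along the path from \<open>i\<close>
  up to, but excluding, the first return to \<open>A\<close>. Unlike the matrix \<open>hat_P\<close>, the function \<open>V f\<close> makes sense at all
  states, and \<open>V f = f + T (V f)\<close> everywhere. All blocks of the statement are values of \<open>V\<close>: with
  \<open>p\<^sub>a i = P(i,a)\<close>, the censored matrix has the entries \<open>V p\<^sub>a i\<close> for \<open>i, a \<in> A\<close>, and the matrix in the bracket
  that the group inverse multiplies is the restriction to the rows in \<open>A\<close> of
  \<open>R i n = V \<delta>\<^sub>n i - V 1 i * \<pi> n\<close>. If \<open>(I - P\<^sup>A) X\<^sub>A = R\<close> holds on \<open>A\<close>, with \<open>P\<^sup>A\<close> the censored matrix, then both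
  blocks of the proposed solution are given by one formula,
  \<open>X i n = (\<Sum>a\<in>A. V p\<^sub>a i * X\<^sub>A a n) + R i n\<close>, and applying \<open>V f = f + T (V f)\<close> to each summand yields
  \<open>X = P X + I - e \<pi>\<^sup>T\<close> (lemmas \<open>X_tilde_eq\<close> and \<open>has_sum_P_X_tilde\<close>).

  It remains to solve \<open>(I - P\<^sup>A) X\<^sub>A = R\<close>. Stationarity gives Kac's formula \<open>\<Sum>i\<in>A. \<pi> i * V f i = \<Sum>i. \<pi> i * f i\<close>
  for bounded \<open>f\<close> (lemma \<open>green_stationary\<close>). Hence the restriction of \<open>\<pi>\<close> to \<open>A\<close> is invariant for \<open>P\<^sup>A\<close>, it
  annihilates \<open>R\<close>, and \<open>V 1\<close>, the expected return time to \<open>A\<close>, is finite. A maximum principle shows that \<open>P\<^sup>A\<close>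
  has only constant harmonic functions. These facts make \<open>W = I - P\<^sup>A\<close> group invertible with
  \<open>W W\<^sup># = I - e p\<^sup>T\<close>, where \<open>p\<close> is \<open>\<pi>\<close> conditioned on \<open>A\<close>, so \<open>W W\<^sup># R = R\<close> (lemma \<open>group_inverse_solves\<close>).

  For the second part, \<open>\<bar>X i n\<bar>\<close> is at most a constant times \<open>V 1 i\<close>. The \<open>\<pi>\<close>-integral of \<open>V 1\<close> is finite because, for
  every state \<open>j\<close>, a path that avoids \<open>A\<close> either avoids \<open>j\<close> too or passes \<open>j\<close> and starts afresh there
  (lemma \<open>green_one_le_add\<close>), and the \<open>\<pi>\<close>-expectation of the return time to \<open>j\<close> bounds the time of avoiding \<open>j\<close>.
  Uniqueness is the fact that a \<open>\<pi>\<close>-integrable harmonic function \<open>f\<close> is constant: the positive part of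
  \<open>f - f j\<close> is subharmonic, hence harmonic by stationarity, nonnegative, and zero at \<open>j\<close>, and by irreducibility such
  a function vanishes.
\<close>

section \<open>Nonnegative integrals and unordered real sums\<close>

text \<open>
  Operators on nonnegative functions are handled by integrals with values in \<open>ennreal\<close>, where Tonelli and
  monotone convergence are unconditional; the following lemmas carry the results over to sums of reals.
\<close>

lemma has_sum_of_nn_integral:
  fixes f :: "'a \<Rightarrow> real"
  assumes "\<And>k. k \<in> S \<Longrightarrow> 0 \<le> f k" and "(\<integral>\<^sup>+ k. ennreal (f k) \<partial>count_space S) = ennreal c" and "0 \<le> c"
  shows "(f has_sum c) S"
proof -
  have *: "integrable (count_space S) f \<and> integral\<^sup>L (count_space S) f = c"
    using assms by (subst nn_integral_eq_integrable[symmetric]) (auto simp: AE_count_space)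
  then have s: "Infinite_Set_Sum.abs_summable_on f S" and i: "infsetsum f S = c"
    by (auto simp: Infinite_Set_Sum.abs_summable_on_def infsetsum_def)
  from s have "f summable_on S"
    using abs_summable_equivalent abs_summable_summable by blast
  moreover have "infsum f S = c"
    using infsetsum_infsum[OF s] i by simp
  ultimately show ?thesis
    by (metis has_sum_infsum)
qed

lemma nn_integral_of_has_sum:
  fixes f :: "'a \<Rightarrow> real"
  assumes "(f has_sum c) S" and "\<And>k. k \<in> S \<Longrightarrow> 0 \<le> f k"
  shows "(\<integral>\<^sup>+ k. ennreal (f k) \<partial>count_space S) = ennreal c"
proof -
  have s: "Infinite_Set_Sum.abs_summable_on f S"
    using assms(1) abs_summable_equivalent summable_on_iff_abs_summable_on_real summable_on_def by blast
  then have "(\<integral>\<^sup>+ k. ennreal (f k) \<partial>count_space S) = ennreal (infsetsum f S)"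
    using assms(2) by (intro nn_integral_conv_infsetsum) auto
  then show ?thesis
    using infsetsum_infsum[OF s] infsumI[OF assms(1)] by simp
qed

text \<open>
  Since \<open>ennreal\<close> truncates negative reals to \<open>0\<close>, the right-hand side is the sum of the positive part. This turns
  an equation for a signed function into a subharmonic inequality for its positive part.
\<close>

lemma ennreal_sum_le_nn_integral:
  fixes f :: "'a \<Rightarrow> real"
  assumes "(f has_sum c) S"
  shows "ennreal c \<le> (\<integral>\<^sup>+ k. ennreal (f k) \<partial>count_space S)"
proof -
  have s: "Infinite_Set_Sum.abs_summable_on f S"
    using assms abs_summable_equivalent summable_on_iff_abs_summable_on_real summable_on_def by blast
  then have int: "integrable (count_space S) f"
    by (simp add: Infinite_Set_Sum.abs_summable_on_def)
  have "c = integral\<^sup>L (count_space S) f"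
    using infsetsum_infsum[OF s] infsumI[OF assms] by (simp add: infsetsum_def)
  also have "ennreal (integral\<^sup>L (count_space S) f) \<le> ennreal (integral\<^sup>L (count_space S) (\<lambda>k. max 0 (f k)))"
    using int by (intro ennreal_leI integral_mono) auto
  also have "\<dots> = (\<integral>\<^sup>+ k. ennreal (max 0 (f k)) \<partial>count_space S)"
    using int by (intro nn_integral_eq_integral[symmetric]) auto
  also have "\<dots> = (\<integral>\<^sup>+ k. ennreal (f k) \<partial>count_space S)"
    by (intro nn_integral_cong) (simp add: max_def ennreal_neg)
  finally show ?thesis .
qed

lemma has_sum_enn2real:
  assumes f: "\<And>k. k \<in> S \<Longrightarrow> f k = enn2real (g k)" and "(\<integral>\<^sup>+ k. g k \<partial>count_space S) = c" and "c < \<top>"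
  shows "(f has_sum enn2real c) S"
proof (rule has_sum_of_nn_integral)
  have "g k < \<top>" if "k \<in> S" for k
    using nn_integral_ge_point[OF that, of g] assms(2,3) by (simp add: le_less_trans)
  then have "(\<integral>\<^sup>+ k. ennreal (f k) \<partial>count_space S) = (\<integral>\<^sup>+ k. g k \<partial>count_space S)"
    by (intro nn_integral_cong) (simp add: f)
  then show "(\<integral>\<^sup>+ k. ennreal (f k) \<partial>count_space S) = ennreal (enn2real c)"
    using assms by simp
qed (simp_all add: f)

lemma mat_mult_enn2real:
  assumes "\<And>k. k \<in> S \<Longrightarrow> X i k = enn2real (x k)" and "\<And>k. k \<in> S \<Longrightarrow> Y k j = enn2real (y k)"
    and "(\<integral>\<^sup>+ k. x k * y k \<partial>count_space S) = c" and "c < \<top>"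
  shows "(X \<cdot>\<^bsub>S\<^esub> Y) i j = enn2real c"
  unfolding mat_mult_def
  using has_sum_enn2real[OF _ assms(3,4), of "\<lambda>k. X i k * Y k j"] assms(1,2)
  by (intro infsumI) (simp add: enn2real_mult)

lemma has_sum_sum_finite:
  fixes F :: "'b \<Rightarrow> 'a \<Rightarrow> real"
  assumes "finite A" and "\<And>a. a \<in> A \<Longrightarrow> (F a has_sum s a) S"
  shows "((\<lambda>k. \<Sum>a\<in>A. F a k) has_sum (\<Sum>a\<in>A. s a)) S"
  using assms by (induction A) (auto intro!: has_sum_add)

lemma nn_integral_count_space_swap:
  fixes F :: "'a::countable \<Rightarrow> 'b::countable \<Rightarrow> ennreal"
  shows "(\<integral>\<^sup>+ x. \<integral>\<^sup>+ y. F x y \<partial>count_space S \<partial>count_space R)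
       = (\<integral>\<^sup>+ y. \<integral>\<^sup>+ x. F x y \<partial>count_space R \<partial>count_space S)"
proof -
  interpret pair_sigma_finite "count_space R" "count_space S"
    by (intro pair_sigma_finite.intro sigma_finite_measure_count_space)
  show ?thesis
  proof (rule Fubini'[symmetric])
    show "case_prod F \<in> borel_measurable (count_space R \<Otimes>\<^sub>M count_space S)"
      by (subst pair_measure_countable) (auto simp: countableI_type)
  qed
qed

text \<open>
  The expansion of a function into unit vectors, restricted to \<open>B\<close>; it lets every operator that commutes with
  nonnegative sums be recovered from its matrix entries.
\<close>

lemma nn_integral_indicator_expand:
  fixes f :: "'a \<Rightarrow> ennreal"
  shows "(\<integral>\<^sup>+ k. f k * indicator {k} l \<partial>count_space B) = f l * indicator B l"
proof -
  have "(\<integral>\<^sup>+ k. f k * indicator {k} l \<partial>count_space B)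
      = (\<integral>\<^sup>+ k. (f l * indicator B l) * indicator {l} k \<partial>count_space UNIV)"
  proof (subst nn_integral_count_space_indicator)
    show "(\<integral>\<^sup>+ k. f k * indicator {k} l * indicator B k \<partial>count_space UNIV)
        = (\<integral>\<^sup>+ k. (f l * indicator B l) * indicator {l} k \<partial>count_space UNIV)"
      by (rule nn_integral_cong) (auto split: split_indicator)
  qed simp
  also have "\<dots> = f l * indicator B l"
    by (subst nn_integral_cmult_indicator) simp_all
  finally show ?thesis .
qed

lemma telescoping_suminf_ennreal:
  fixes a s :: "nat \<Rightarrow> ennreal"
  assumes "\<And>n. s n = a n + s (Suc n)" and "s \<longlonglongrightarrow> 0"
  shows "(\<Sum>n. a n) = s 0"
proof -
  have "s 0 = (\<Sum>n<N. a n) + s N" for N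
  proof (induction N)
    case (Suc N)
    then show ?case
      using assms(1)[of N] by (simp add: add.assoc)
  qed simp
  then have "(\<lambda>N. s 0) = (\<lambda>N. (\<Sum>n<N. a n) + s N)"
    by (rule ext)
  then have "(\<lambda>N. (\<Sum>n<N. a n) + s N) \<longlonglongrightarrow> s 0"
    by (rule subst) (rule tendsto_const)
  moreover have "(\<lambda>N. (\<Sum>n<N. a n) + s N) \<longlonglongrightarrow> (\<Sum>n. a n) + 0"
    by (intro tendsto_add summable_LIMSEQ assms(2)) auto
  ultimately show ?thesis
    using LIMSEQ_unique by fastforce
qed

section \<open>The killed transition operator and its Green operator\<close>

text \<open>
  \<open>taboo K B f i\<close> is the expectation of \<open>f(\<Phi>\<^sub>1)\<close> on the event \<open>\<Phi>\<^sub>1 \<in> B\<close>, started at \<open>i\<close>. The starting point is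
  deliberately not required to lie in \<open>B\<close>: at \<open>i \<in> B\<close> this is the block \<open>P\<^sub>B\<^sub>B\<close>, elsewhere the rows of \<open>P\<close> that
  enter \<open>B\<close>, so one operator serves for both kinds of rows.
\<close>

definition taboo :: "('s \<Rightarrow> 's pmf) \<Rightarrow> 's set \<Rightarrow> ('s \<Rightarrow> ennreal) \<Rightarrow> 's \<Rightarrow> ennreal" where
  "taboo K B f i = (\<integral>\<^sup>+ k. f k * indicator B k \<partial>measure_pmf (K i))"

text \<open>
  The expected sum of \<open>f\<close> along the path until it first leaves \<open>B\<close> after time \<open>0\<close>; the term at time \<open>0\<close>
  is counted even if the start is outside \<open>B\<close>.
\<close>

definition green :: "('s \<Rightarrow> 's pmf) \<Rightarrow> 's set \<Rightarrow> ('s \<Rightarrow> ennreal) \<Rightarrow> 's \<Rightarrow> ennreal" where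
  "green K B f i = (\<Sum>n. (taboo K B ^^ n) f i)"

lemma taboo_mono: "(\<And>k. k \<in> B \<Longrightarrow> f k \<le> g k) \<Longrightarrow> taboo K B f i \<le> taboo K B g i"
  unfolding taboo_def by (intro nn_integral_mono) (auto simp: indicator_def)

lemma taboo_cong: "(\<And>k. k \<in> B \<Longrightarrow> f k = g k) \<Longrightarrow> taboo K B f i = taboo K B g i"
  unfolding taboo_def by (intro nn_integral_cong) (auto simp: indicator_def)

lemma taboo_pow_mono: "(\<And>k. f k \<le> g k) \<Longrightarrow> (taboo K B ^^ n) f i \<le> (taboo K B ^^ n) g i"
  by (induction n arbitrary: i) (auto intro: taboo_mono)

lemma taboo_pow_cong:
  assumes "\<And>k. k \<in> B \<Longrightarrow> f k = g k" and "i \<in> B"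
  shows "(taboo K B ^^ n) f i = (taboo K B ^^ n) g i"
  using assms(2)
proof (induction n arbitrary: i)
  case (Suc n)
  then show ?case by (auto intro: taboo_cong)
qed (simp add: assms(1))

lemma taboo_pow_0 [simp]: "(taboo K B ^^ n) (\<lambda>_. 0) i = 0"
proof -
  have "(taboo K B ^^ n) (\<lambda>_. 0) = (\<lambda>_. 0)"
    by (induction n) (auto simp: taboo_def fun_eq_iff)
  then show ?thesis by simp
qed

lemma taboo_add: "taboo K B (\<lambda>k. f k + g k) i = taboo K B f i + taboo K B g i"
  unfolding taboo_def by (simp add: distrib_right nn_integral_add)

lemma taboo_cmult: "taboo K B (\<lambda>k. c * f k) i = c * taboo K B f i"
  unfolding taboo_def by (simp add: mult.assoc nn_integral_cmult)

lemma taboo_sum: "finite S \<Longrightarrow> taboo K B (\<lambda>k. \<Sum>a\<in>S. F a k) i = (\<Sum>a\<in>S. taboo K B (F a) i)"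
  unfolding taboo_def sum_distrib_right by (rule nn_integral_sum) simp

lemma taboo_suminf: "taboo K B (\<lambda>k. \<Sum>n. F n k) i = (\<Sum>n. taboo K B (F n) i)"
  unfolding taboo_def by (simp add: nn_integral_suminf flip: ennreal_suminf_multc)

lemma taboo_const_le: "taboo K B (\<lambda>_. c) i \<le> c"
proof -
  have "taboo K B (\<lambda>_. c) i \<le> (\<integral>\<^sup>+ k. c \<partial>measure_pmf (K i))"
    unfolding taboo_def by (intro nn_integral_mono) (auto simp: indicator_def)
  also have "\<dots> = c"
    by (simp add: measure_pmf.emeasure_space_1)
  finally show ?thesis .
qed

lemma taboo_count_space:
  "taboo K B f i = (\<integral>\<^sup>+ k. ennreal (pmf (K i) k) * f k \<partial>count_space B)"
proof -
  have "taboo K B f i = (\<integral>\<^sup>+ k. ennreal (pmf (K i) k) * f k * indicator B k \<partial>count_space UNIV)"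
    unfolding taboo_def nn_integral_measure_pmf by (simp add: mult.assoc)
  also have "\<dots> = (\<integral>\<^sup>+ k. ennreal (pmf (K i) k) * f k \<partial>count_space B)"
    by (subst nn_integral_count_space_indicator[of B]) auto
  finally show ?thesis .
qed

lemma taboo_nn_integral:
  fixes K :: "'s::countable \<Rightarrow> 's pmf" and F :: "'a::countable \<Rightarrow> 's \<Rightarrow> ennreal"
  shows "taboo K B (\<lambda>k. \<integral>\<^sup>+ j. F j k \<partial>count_space S) i = (\<integral>\<^sup>+ j. taboo K B (F j) i \<partial>count_space S)"
proof -
  have "taboo K B (\<lambda>k. \<integral>\<^sup>+ j. F j k \<partial>count_space S) i
      = (\<integral>\<^sup>+ k. \<integral>\<^sup>+ j. ennreal (pmf (K i) k) * F j k \<partial>count_space S \<partial>count_space B)"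
    unfolding taboo_count_space by (simp add: nn_integral_cmult)
  also have "\<dots> = (\<integral>\<^sup>+ j. \<integral>\<^sup>+ k. ennreal (pmf (K i) k) * F j k \<partial>count_space B \<partial>count_space S)"
    by (rule nn_integral_count_space_swap)
  finally show ?thesis
    unfolding taboo_count_space .
qed

lemma taboo_pow_cmult: "(taboo K B ^^ n) (\<lambda>k. c * f k) i = c * (taboo K B ^^ n) f i"
proof -
  have "(taboo K B ^^ n) (\<lambda>k. c * f k) = (\<lambda>i. c * (taboo K B ^^ n) f i)"
    by (induction n) (simp_all add: ext[OF taboo_cmult])
  then show ?thesis by simp
qed

lemma taboo_pow_add: "(taboo K B ^^ n) (\<lambda>k. f k + g k) i = (taboo K B ^^ n) f i + (taboo K B ^^ n) g i"
proof -
  have "(taboo K B ^^ n) (\<lambda>k. f k + g k) = (\<lambda>i. (taboo K B ^^ n) f i + (taboo K B ^^ n) g i)"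
    by (induction n) (simp_all add: ext[OF taboo_add])
  then show ?thesis by simp
qed

lemma taboo_pow_sum: "finite S \<Longrightarrow> (taboo K B ^^ n) (\<lambda>k. \<Sum>a\<in>S. F a k) i = (\<Sum>a\<in>S. (taboo K B ^^ n) (F a) i)"
proof -
  assume "finite S"
  then have "(taboo K B ^^ n) (\<lambda>k. \<Sum>a\<in>S. F a k) = (\<lambda>i. \<Sum>a\<in>S. (taboo K B ^^ n) (F a) i)"
    by (induction n) (simp_all add: ext[OF taboo_sum])
  then show ?thesis by simp
qed

lemma taboo_pow_nn_integral:
  fixes K :: "'s::countable \<Rightarrow> 's pmf" and F :: "'a::countable \<Rightarrow> 's \<Rightarrow> ennreal"
  shows "(taboo K B ^^ n) (\<lambda>k. \<integral>\<^sup>+ j. F j k \<partial>count_space S) i = (\<integral>\<^sup>+ j. (taboo K B ^^ n) (F j) i \<partial>count_space S)"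
proof -
  have "(taboo K B ^^ n) (\<lambda>k. \<integral>\<^sup>+ j. F j k \<partial>count_space S) = (\<lambda>i. \<integral>\<^sup>+ j. (taboo K B ^^ n) (F j) i \<partial>count_space S)"
    by (induction n) (simp_all add: ext[OF taboo_nn_integral])
  then show ?thesis by simp
qed

lemma green_unfold: "green K B f i = f i + taboo K B (green K B f) i"
proof -
  have "green K B f i = f i + (\<Sum>n. (taboo K B ^^ Suc n) f i)"
    unfolding green_def using suminf_offset[of "\<lambda>n. (taboo K B ^^ n) f i" 1] by (simp add: add.commute)
  then show ?thesis
    by (simp add: green_def[abs_def] taboo_suminf)
qed

lemma green_mono: "(\<And>k. f k \<le> g k) \<Longrightarrow> green K B f i \<le> green K B g i"
  unfolding green_def by (intro suminf_le taboo_pow_mono) auto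

lemma green_cong: "(\<And>k. k \<in> B \<Longrightarrow> f k = g k) \<Longrightarrow> i \<in> B \<Longrightarrow> green K B f i = green K B g i"
  unfolding green_def by (intro suminf_cong taboo_pow_cong)

lemma green_cmult: "green K B (\<lambda>k. c * f k) i = c * green K B f i"
  unfolding green_def by (simp add: taboo_pow_cmult)

lemma green_sum: "finite S \<Longrightarrow> green K B (\<lambda>k. \<Sum>a\<in>S. F a k) i = (\<Sum>a\<in>S. green K B (F a) i)"
  unfolding green_def by (simp add: taboo_pow_sum suminf_sum)

lemma green_nn_integral:
  fixes K :: "'s::countable \<Rightarrow> 's pmf" and F :: "'a::countable \<Rightarrow> 's \<Rightarrow> ennreal"
  shows "green K B (\<lambda>k. \<integral>\<^sup>+ j. F j k \<partial>count_space S) i = (\<integral>\<^sup>+ j. green K B (F j) i \<partial>count_space S)"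
  unfolding green_def by (simp add: taboo_pow_nn_integral nn_integral_suminf)

lemma taboo_pow_le_green: "(taboo K B ^^ n) f i \<le> green K B f i"
  unfolding green_def using sum_le_suminf[of "\<lambda>n. (taboo K B ^^ n) f i" "{n}"] by simp

lemma taboo_pow_green_le: "(taboo K B ^^ n) (green K B f) i \<le> green K B f i"
proof (induction n arbitrary: i)
  case (Suc n)
  have "(taboo K B ^^ Suc n) (green K B f) i \<le> taboo K B (green K B f) i"
    using Suc by (auto intro: taboo_mono)
  also have "\<dots> \<le> green K B f i"
    using green_unfold[of K B f i] by simp
  finally show ?case .
qed simp

lemma survival_decseq: "decseq (\<lambda>n. (taboo K B ^^ n) (\<lambda>_. 1) i)"
proof (rule decseq_SucI)
  fix n
  show "(taboo K B ^^ Suc n) (\<lambda>_. 1) i \<le> (taboo K B ^^ n) (\<lambda>_. 1) i"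
    unfolding funpow_Suc_right o_apply by (intro taboo_pow_mono taboo_const_le)
qed

lemma survival_le_1: "(taboo K B ^^ n) (\<lambda>_. 1) i \<le> 1"
  using survival_decseq[of K B i] by (auto dest: decseqD[of _ 0 n])

text \<open>
  The rows outside \<open>B\<close> are excluded because there the term \<open>n = 0\<close> would be \<open>f i\<close> on the right-hand side and
  \<open>0\<close> on the left.
\<close>

lemma taboo_pow_kernel:
  fixes K :: "'s::countable \<Rightarrow> 's pmf"
  assumes "i \<in> B"
  shows "(\<integral>\<^sup>+ k. (taboo K B ^^ n) (indicator {k}) i * f k \<partial>count_space B) = (taboo K B ^^ n) f i"
proof -
  have "(\<integral>\<^sup>+ k. (taboo K B ^^ n) (indicator {k}) i * f k \<partial>count_space B)
      = (taboo K B ^^ n) (\<lambda>l. f l * indicator B l) i"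
    by (simp add: mult.commute[of _ "f _"] nn_integral_indicator_expand
        flip: taboo_pow_cmult taboo_pow_nn_integral)
  then show ?thesis
    using assms by (subst taboo_pow_cong[of B f "\<lambda>l. f l * indicator B l"]) auto
qed

lemma green_kernel:
  fixes K :: "'s::countable \<Rightarrow> 's pmf"
  assumes "i \<in> B"
  shows "(\<integral>\<^sup>+ k. green K B (indicator {k}) i * f k \<partial>count_space B) = green K B f i"
proof -
  have "(\<integral>\<^sup>+ k. green K B (indicator {k}) i * f k \<partial>count_space B)
      = green K B (\<lambda>l. f l * indicator B l) i"
    by (simp add: mult.commute[of _ "f _"] nn_integral_indicator_expand
        flip: green_cmult green_nn_integral)
  then show ?thesis
    using assms by (subst green_cong[of B f "\<lambda>l. f l * indicator B l"]) auto
qed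

lemma taboo_green_kernel:
  fixes K :: "'s::countable \<Rightarrow> 's pmf"
  shows "(\<integral>\<^sup>+ k. taboo K B (green K B (indicator {k})) i * f k \<partial>count_space B) = taboo K B (green K B f) i"
proof -
  have "(\<integral>\<^sup>+ k. taboo K B (green K B (indicator {k})) i * f k \<partial>count_space B)
      = taboo K B (\<lambda>l. \<integral>\<^sup>+ k. green K B (indicator {k}) l * f k \<partial>count_space B) i"
    by (simp add: mult.commute[of _ "f _"] flip: taboo_cmult taboo_nn_integral)
  also have "\<dots> = taboo K B (green K B f) i"
    by (intro taboo_cong green_kernel)
  finally show ?thesis .
qed

text \<open>
  The powers of a matrix multiply by new factors on the right, the iterated operator on the left; the
  expansion into unit vectors reconciles the two. The restriction to rows and columns in \<open>B\<close> cannot be dropped: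
  with a column outside \<open>B\<close> the matrix power also counts the step that leaves \<open>B\<close>.
\<close>

lemma mat_pow_taboo:
  fixes K :: "'s::countable \<Rightarrow> 's pmf"
  assumes i: "i \<in> B" and "j \<in> B"
  shows "mat_pow B (tmat K) n i j = enn2real ((taboo K B ^^ n) (indicator {j}) i)"
  using assms(2)
proof (induction n arbitrary: j)
  case 0
  then show ?case by (simp add: ident_def indicator_def)
next
  case (Suc n)
  have step: "taboo K B (indicator {j}) = (\<lambda>k. ennreal (pmf (K k) j))"
    using Suc.prems by (auto simp: fun_eq_iff taboo_def emeasure_pmf_single indicator_inter_arith[symmetric])
  have *: "(\<integral>\<^sup>+ k. (taboo K B ^^ n) (indicator {k}) i * ennreal (pmf (K k) j) \<partial>count_space B) = (taboo K B ^^ Suc n) (indicator {j}) i"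
    unfolding funpow_Suc_right o_apply step by (rule taboo_pow_kernel[OF i])
  have "(taboo K B ^^ Suc n) (indicator {j}) i \<le> (taboo K B ^^ Suc n) (\<lambda>_. 1) i"
    by (intro taboo_pow_mono) (simp add: indicator_def)
  also have "\<dots> \<le> 1" by (rule survival_le_1)
  finally have "(taboo K B ^^ Suc n) (indicator {j}) i < \<top>"
    by (simp add: le_less_trans)
  then show ?case
    unfolding mat_pow.simps by (intro mat_mult_enn2real[OF _ _ *]) (simp_all add: Suc.IH tmat_def)
qed

text \<open>
  The mean time in \<open>B\<close> is at most the mean time until \<open>i\<close> is visited plus the mean time in \<open>B\<close> from there. The strong
  Markov property is replaced by induction on truncations: the number of steps up to time \<open>N\<close> satisfies the
  recursion \<open>u\<^sub>N\<^sub>+\<^sub>1 = 1 + T u\<^sub>N\<close>, and the bound is used at the next state, except at \<open>i\<close> itself, where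
  \<open>u\<^sub>N\<close> is compared with its limit.
\<close>

lemma green_one_le_add:
  "green K B (\<lambda>_. 1) j \<le> green K (- {i}) (\<lambda>_. 1) j + green K B (\<lambda>_. 1) i"
proof -
  let ?u = "\<lambda>N j. \<Sum>n<(N::nat). (taboo K B ^^ n) (\<lambda>_. 1) j"
  let ?U = "green K B (\<lambda>_. 1)" and ?V = "green K (- {i}) (\<lambda>_. 1)"
  have u_le: "?u N k \<le> ?U k" for N k
    unfolding green_def by (intro sum_le_suminf) auto
  have "?u N j \<le> ?V j + ?U i" for N
  proof (induction N arbitrary: j)
    case (Suc N)
    have "?u (Suc N) j = 1 + taboo K B (?u N) j"
      unfolding sum.lessThan_Suc_shift by (simp add: taboo_sum)
    also have "taboo K B (?u N) j \<le> taboo K UNIV (\<lambda>k. ?V k * indicator (- {i}) k + ?U i) j"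
    proof -
      have "?u N k * indicator B k \<le> (?V k * indicator (- {i}) k + ?U i) * indicator UNIV k" for k
        using u_le[where N = N and k = i] Suc.IH[of k] by (cases "k = i") (auto simp: indicator_def)
      then show ?thesis
        unfolding taboo_def[of K B "?u N"] taboo_def[of K UNIV] by (rule nn_integral_mono)
    qed
    also have "taboo K UNIV (\<lambda>k. ?V k * indicator (- {i}) k + ?U i) j = taboo K (- {i}) ?V j + ?U i"
      unfolding taboo_def by (simp add: nn_integral_add measure_pmf.emeasure_space_1)
    also have "1 + (taboo K (- {i}) ?V j + ?U i) = ?V j + ?U i"
      using green_unfold[of K "- {i}" "\<lambda>_. 1" j] by (simp add: add.assoc)
    finally show ?case by (simp add: add_left_mono)
  qed simp
  then show ?thesis
    unfolding green_def[of K B "\<lambda>_. 1" j] by (intro suminf_le_const) auto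
qed

section \<open>Irreducible chains with an invariant probability vector\<close>

locale stationary_chain =
  fixes K :: "'s::countable \<Rightarrow> 's pmf" and \<pi> :: "'s pmf"
  assumes irreducible: "irreducible_chain K" and invariant: "invariant_pmf K \<pi>"
begin

text \<open>
  Vanishing and positivity are proved below by exhibiting a closed set of states. A positive entry of \<open>P\<^sup>n\<close> comes
  from a path of positive transitions, and such a path cannot leave a closed set.
\<close>

lemma closed_set_UNIV:
  assumes "a \<in> S" and closed: "\<And>i k. i \<in> S \<Longrightarrow> pmf (K i) k \<noteq> 0 \<Longrightarrow> k \<in> S"
  shows "j \<in> S"
proof -
  have "j \<in> S" if "mat_pow UNIV (tmat K) n a j \<noteq> 0" for n j
    using that
  proof (induction n arbitrary: j)
    case 0
    then show ?case using \<open>a \<in> S\<close> by (simp add: ident_def split: if_splits)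
  next
    case (Suc n)
    then obtain k where "mat_pow UNIV (tmat K) n a k * tmat K k j \<noteq> 0"
      unfolding mat_pow.simps mat_mult_def by (meson infsum_0)
    then show ?case using Suc.IH[of k] closed[of k j] by (auto simp: tmat_def[of K k j])
  qed
  moreover obtain n where "mat_pow UNIV (tmat K) n a j > 0"
    using irreducible by (auto simp: irreducible_chain_def)
  ultimately show ?thesis
    by (metis less_irrefl)
qed

text \<open>
  Minimum principle: at a zero of a nonnegative superharmonic function all successor states are zeros too, so the set of
  zeros is closed under transitions.
\<close>

lemma superharmonic_zero:
  assumes "\<And>i. (\<integral>\<^sup>+ k. g k \<partial>measure_pmf (K i)) \<le> g i" and "g a = (0::ennreal)"
  shows "g j = 0"
proof -
  have "j \<in> {i. g i = 0}"
  proof (rule closed_set_UNIV)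
    fix i k assume "i \<in> {i. g i = 0}" and k: "pmf (K i) k \<noteq> 0"
    then have "(\<integral>\<^sup>+ k. g k \<partial>measure_pmf (K i)) = 0"
      using assms(1)[of i] by simp
    then show "k \<in> {i. g i = 0}"
      using k by (simp add: nn_integral_0_iff_AE AE_measure_pmf_iff set_pmf_iff)
  qed (use assms(2) in simp)
  then show ?thesis by simp
qed

lemma bind_invariant: "bind_pmf \<pi> K = \<pi>"
proof (rule pmf_eqI)
  fix j
  have "ennreal (pmf (bind_pmf \<pi> K) j) = (\<integral>\<^sup>+ i. ennreal (pmf \<pi> i * tmat K i j) \<partial>count_space UNIV)"
    by (simp add: ennreal_pmf_bind nn_integral_measure_pmf tmat_def ennreal_mult)
  also have "\<dots> = ennreal (pmf \<pi> j)"
    using invariant by (intro nn_integral_of_has_sum) (auto simp: invariant_pmf_def tmat_def)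
  finally show "pmf (bind_pmf \<pi> K) j = pmf \<pi> j" by simp
qed

lemma nn_integral_stationary:
  "(\<integral>\<^sup>+ i. \<integral>\<^sup>+ k. f k \<partial>measure_pmf (K i) \<partial>measure_pmf \<pi>) = (\<integral>\<^sup>+ i. f i \<partial>measure_pmf \<pi>)"
  by (metis bind_invariant nn_integral_bind_pmf)

lemma pi_pos: "pmf \<pi> j > 0"
proof -
  obtain a where "a \<in> set_pmf \<pi>"
    using set_pmf_not_empty by fast
  then have "j \<in> set_pmf \<pi>"
  proof (rule closed_set_UNIV)
    fix i k assume "i \<in> set_pmf \<pi>" "pmf (K i) k \<noteq> 0"
    then have "k \<in> set_pmf (bind_pmf \<pi> K)"
      by (auto simp: set_pmf_iff)
    then show "k \<in> set_pmf \<pi>" by (simp add: bind_invariant)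
  qed
  then show ?thesis by (simp add: pmf_positive)
qed

lemma AE_pi_iff: "(AE i in measure_pmf \<pi>. Q i) \<longleftrightarrow> (\<forall>i. Q i)"
proof -
  have "set_pmf \<pi> = UNIV"
    using pi_pos by (auto simp: set_pmf_iff less_imp_neq[THEN not_sym])
  then show ?thesis by (simp add: AE_measure_pmf_iff)
qed

text \<open>
  By stationarity the nonnegative function \<open>P g - g\<close> has integral \<open>0\<close> against \<open>\<pi>\<close>, and \<open>\<pi>\<close> charges every
  state. Integrability is what permits the subtraction.
\<close>

lemma integrable_subharmonic_harmonic:
  assumes sub: "\<And>i. g i \<le> (\<integral>\<^sup>+ k. g k \<partial>measure_pmf (K i))"
    and fin: "(\<integral>\<^sup>+ i. g i \<partial>measure_pmf \<pi>) < \<infinity>"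
  shows "(\<integral>\<^sup>+ k. g k \<partial>measure_pmf (K i)) = g i"
proof -
  let ?h = "\<lambda>i. (\<integral>\<^sup>+ k. g k \<partial>measure_pmf (K i)) - g i"
  have "(\<integral>\<^sup>+ i. ?h i \<partial>measure_pmf \<pi>)
      = (\<integral>\<^sup>+ i. \<integral>\<^sup>+ k. g k \<partial>measure_pmf (K i) \<partial>measure_pmf \<pi>) - (\<integral>\<^sup>+ i. g i \<partial>measure_pmf \<pi>)"
    using fin sub by (intro nn_integral_diff) auto
  also have "\<dots> = 0"
    using fin by (simp add: nn_integral_stationary)
  finally have "?h i = 0"
    by (simp add: nn_integral_0_iff_AE AE_pi_iff)
  moreover have "g i < \<infinity>"
    using nn_integral_PInf_AE[of g "measure_pmf \<pi>"] fin by (simp add: AE_pi_iff less_top)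
  ultimately show ?thesis
    using sub[of i] by (metis diff_add_cancel_ennreal add.left_neutral)
qed

lemma nn_integral_taboo:
  "(\<integral>\<^sup>+ i. taboo K B f i \<partial>measure_pmf \<pi>) = (\<integral>\<^sup>+ i. f i * indicator B i \<partial>measure_pmf \<pi>)"
  unfolding taboo_def by (rule nn_integral_stationary)

lemma nn_integral_split_taboo:
  "(\<integral>\<^sup>+ i. f i \<partial>measure_pmf \<pi>)
    = (\<integral>\<^sup>+ i. f i * indicator A i \<partial>measure_pmf \<pi>) + (\<integral>\<^sup>+ i. taboo K (- A) f i \<partial>measure_pmf \<pi>)"
  unfolding nn_integral_taboo
  by (subst nn_integral_add[symmetric]) (auto simp: indicator_def intro!: nn_integral_cong)

text \<open>
  Recurrence of \<open>A\<close> follows from stationarity. The limit \<open>h\<close> of the survival probabilities satisfies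
  \<open>T h = h\<close> everywhere. Integrating against \<open>\<pi>\<close> shows that \<open>h\<close> vanishes on \<open>A\<close>; then \<open>h\<close> is harmonic for the
  whole chain and has a zero, so it vanishes everywhere.
\<close>

lemma survival_tendsto_0:
  assumes "a \<in> A"
  shows "(\<lambda>n. (taboo K (- A) ^^ n) (\<lambda>_. 1) i) \<longlonglongrightarrow> 0"
proof -
  let ?s = "\<lambda>n i. (taboo K (- A) ^^ n) (\<lambda>_. 1) i"
  define h where "h i = (INF n. ?s n i)" for i
  have h_le: "h i \<le> 1" for i
    unfolding h_def by (rule INF_lower2[of 0]) auto
  have lim: "(\<lambda>n. ?s n i) \<longlonglongrightarrow> h i" for i
    unfolding h_def by (rule LIMSEQ_INF[OF survival_decseq])
  have "taboo K (- A) h i = (INF n. taboo K (- A) (?s n) i)" for i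
  proof -
    have "taboo K (- A) h i = (\<integral>\<^sup>+ k. (INF n. ?s n k * indicator (- A) k) \<partial>measure_pmf (K i))"
      unfolding taboo_def h_def by (intro nn_integral_cong) (auto simp: indicator_def)
    also have "\<dots> = (INF n. (\<integral>\<^sup>+ k. ?s n k * indicator (- A) k \<partial>measure_pmf (K i)))"
    proof (rule nn_integral_monotone_convergence_INF_decseq)
      show "decseq (\<lambda>n k. ?s n k * indicator (- A) k)"
        by (intro decseq_SucI le_funI mult_right_mono decseq_SucD[OF survival_decseq]) simp
      show "(\<integral>\<^sup>+ k. ?s 0 k * indicator (- A) k \<partial>measure_pmf (K i)) < \<infinity>"
        using taboo_const_le[of K "- A" 1 i] by (simp add: taboo_def le_less_trans)
    qed auto
    finally show ?thesis by (simp add: taboo_def)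
  qed
  moreover have "(INF n. taboo K (- A) (?s n) i) = h i" for i
  proof (rule LIMSEQ_unique)
    have "decseq (\<lambda>n. ?s (Suc n) i)"
      using survival_decseq[of K "- A" i] by (intro decseq_SucI) (rule decseq_SucD)
    then show "(\<lambda>n. ?s (Suc n) i) \<longlonglongrightarrow> (INF n. taboo K (- A) (?s n) i)"
      using LIMSEQ_INF[of "\<lambda>n. ?s (Suc n) i"] by simp
    show "(\<lambda>n. ?s (Suc n) i) \<longlonglongrightarrow> h i"
      by (rule LIMSEQ_Suc[OF lim])
  qed
  ultimately have harm: "taboo K (- A) h i = h i" for i by simp
  have "(\<integral>\<^sup>+ i. h i \<partial>measure_pmf \<pi>) \<le> (\<integral>\<^sup>+ i. 1 \<partial>measure_pmf \<pi>)"
    by (intro nn_integral_mono h_le)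
  then have "(\<integral>\<^sup>+ i. h i \<partial>measure_pmf \<pi>) < \<top>"
    by (simp add: measure_pmf.emeasure_space_1 le_less_trans)
  then have "(\<integral>\<^sup>+ i. h i * indicator A i \<partial>measure_pmf \<pi>) = 0"
    using ennreal_add_diff_cancel_right[of "\<integral>\<^sup>+ i. h i \<partial>measure_pmf \<pi>" "\<integral>\<^sup>+ i. h i * indicator A i \<partial>measure_pmf \<pi>"]
      nn_integral_split_taboo[of h A, unfolded harm, symmetric]
    by (metis ennreal_diff_self less_irrefl)
  then have h0: "i \<in> A \<Longrightarrow> h i = 0" for i
    by (auto simp: nn_integral_0_iff_AE AE_pi_iff indicator_def)
  have "(\<integral>\<^sup>+ k. h k \<partial>measure_pmf (K i)) = taboo K (- A) h i" for i
    unfolding taboo_def by (intro nn_integral_cong) (auto simp: h0 indicator_def)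
  then have "h i = 0"
    using superharmonic_zero[of h a i] h0[OF assms] harm by (metis order_refl)
  then show ?thesis using lim[of i] by simp
qed

text \<open>
  Kac's formula: \<open>\<pi>\<close> is recovered from its restriction to \<open>A\<close> by running the chain until it returns to \<open>A\<close>.
  Stationarity gives \<open>\<pi> g = \<pi>\<^sub>A g + \<pi> (T g)\<close>; applied to \<open>g = T\<^sup>n f\<close> the series telescopes, and its remainder vanishes
  by recurrence of \<open>A\<close>.
\<close>

lemma green_stationary:
  assumes "a \<in> A" and bound: "\<And>i. f i \<le> c" and "c < \<top>"
  shows "(\<integral>\<^sup>+ i. green K (- A) f i * indicator A i \<partial>measure_pmf \<pi>) = (\<integral>\<^sup>+ i. f i \<partial>measure_pmf \<pi>)"
proof -
  let ?T = "\<lambda>n. (taboo K (- A) ^^ n)"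
  let ?r = "\<lambda>n. \<integral>\<^sup>+ i. ?T n f i \<partial>measure_pmf \<pi>" and ?s = "\<lambda>n. \<integral>\<^sup>+ i. ?T n (\<lambda>_. 1) i \<partial>measure_pmf \<pi>"
  have "?s \<longlonglongrightarrow> (\<integral>\<^sup>+ i. 0 \<partial>measure_pmf \<pi>)"
    by (rule nn_integral_dominated_convergence[where w = "\<lambda>_. 1"])
      (auto simp: survival_tendsto_0[OF assms(1)] survival_le_1 measure_pmf.emeasure_space_1)
  then have upper: "(\<lambda>n. c * ?s n) \<longlonglongrightarrow> c * 0"
    using \<open>c < \<top>\<close> by (intro ennreal_tendsto_cmult) auto
  have le: "?r n \<le> c * ?s n" for n
  proof -
    have "?T n f i \<le> c * ?T n (\<lambda>_. 1) i" for i
      using taboo_pow_mono[of f "\<lambda>_. c * 1" n K "- A" i] bound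
      by (simp only: taboo_pow_cmult) simp
    then show ?thesis
      by (subst nn_integral_cmult[symmetric]) (auto intro: nn_integral_mono)
  qed
  have lim: "?r \<longlonglongrightarrow> 0"
  proof (rule tendsto_sandwich[of "\<lambda>_. 0" ?r _ "\<lambda>n. c * ?s n"])
    show "(\<lambda>n. c * ?s n) \<longlonglongrightarrow> 0"
      using upper by simp
    show "\<forall>\<^sub>F n in sequentially. ?r n \<le> c * ?s n"
      by (rule always_eventually[OF allI[OF le]])
  qed simp_all
  have "(\<Sum>n. \<integral>\<^sup>+ i. ?T n f i * indicator A i \<partial>measure_pmf \<pi>) = (\<integral>\<^sup>+ i. ?T 0 f i \<partial>measure_pmf \<pi>)"
  proof (rule telescoping_suminf_ennreal[OF _ lim])
    show "(\<integral>\<^sup>+ i. ?T n f i \<partial>measure_pmf \<pi>) = (\<integral>\<^sup>+ i. ?T n f i * indicator A i \<partial>measure_pmf \<pi>)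
        + (\<integral>\<^sup>+ i. ?T (Suc n) f i \<partial>measure_pmf \<pi>)" for n
      by (subst nn_integral_split_taboo[of _ A]) simp
  qed
  then show ?thesis
    unfolding green_def by (simp add: nn_integral_suminf flip: ennreal_suminf_multc)
qed

text \<open>
  Kac's formula with \<open>f = 1\<close> gives finiteness on \<open>A\<close> only. With \<open>f\<close> the indicator of \<open>i\<close> it shows that \<open>i\<close> is
  reached, before the return to \<open>A\<close>, with positive probability from some state of \<open>A\<close>, so an infinite value at
  \<open>i\<close> would be passed on to that state.
\<close>

lemma green_one_finite:
  assumes "a \<in> A"
  shows "green K (- A) (\<lambda>_. 1) i < \<top>"
proof -
  let ?V = "green K (- A)"
  have "(\<integral>\<^sup>+ j. ?V (\<lambda>_. 1) j * indicator A j \<partial>measure_pmf \<pi>) = 1"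
    by (subst green_stationary[OF assms, of _ 1]) (auto simp: measure_pmf.emeasure_space_1)
  then have finA: "j \<in> A \<Longrightarrow> ?V (\<lambda>_. 1) j \<noteq> \<top>" for j
    using nn_integral_PInf_AE[of "\<lambda>j. ?V (\<lambda>_. 1) j * indicator A j" "measure_pmf \<pi>"]
    by (auto simp: AE_pi_iff dest!: spec[of _ j])
  have "(\<integral>\<^sup>+ j. ?V (indicator {i}) j * indicator A j \<partial>measure_pmf \<pi>) = (\<integral>\<^sup>+ j. indicator {i} j \<partial>measure_pmf \<pi>)"
    by (subst green_stationary[OF assms, of _ 1]) (auto simp: indicator_def)
  also have "\<dots> \<noteq> 0"
    using pi_pos[of i] by (simp add: emeasure_pmf_single)
  finally have "\<not> (\<forall>j. ?V (indicator {i}) j * indicator A j = 0)"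
    by (auto simp: nn_integral_0_iff_AE)
  then obtain j where j: "j \<in> A" "?V (indicator {i}) j \<noteq> 0"
    by (auto simp: indicator_def split: if_splits)
  then obtain m where m: "(taboo K (- A) ^^ m) (indicator {i}) j \<noteq> 0"
    unfolding green_def by fastforce
  have "?V (\<lambda>_. 1) i * (taboo K (- A) ^^ m) (indicator {i}) j
      = (taboo K (- A) ^^ m) (\<lambda>k. ?V (\<lambda>_. 1) i * indicator {i} k) j"
    by (simp add: taboo_pow_cmult)
  also have "\<dots> \<le> (taboo K (- A) ^^ m) (?V (\<lambda>_. 1)) j"
    by (intro taboo_pow_mono) (auto simp: indicator_def)
  also have "\<dots> \<le> ?V (\<lambda>_. 1) j"
    by (rule taboo_pow_green_le)
  finally show ?thesis
    using finA[OF j(1)] m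
    by (cases "?V (\<lambda>_. 1) i = \<top>") (auto simp: less_top[symmetric] top_unique ennreal_top_mult)
qed

text \<open>
  The chain returns to \<open>A\<close> with probability one: the exit probabilities \<open>T\<^sup>n P(\<cdot>,A)\<close> are the differences of successive
  survival probabilities.
\<close>

lemma green_exit_eq_1:
  assumes "a \<in> A"
  shows "green K (- A) (\<lambda>i. emeasure (measure_pmf (K i)) A) i = 1"
proof -
  let ?T = "\<lambda>n. (taboo K (- A) ^^ n)" and ?g = "\<lambda>i. emeasure (measure_pmf (K i)) A"
  have *: "(\<lambda>_. 1) = (\<lambda>i. ?g i + taboo K (- A) (\<lambda>_. 1) i)"
  proof
    fix i
    have "1 = emeasure (measure_pmf (K i)) (A \<union> - A)"
      by (simp add: measure_pmf.emeasure_space_1)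
    also have "\<dots> = ?g i + emeasure (measure_pmf (K i)) (- A)"
      by (rule plus_emeasure[symmetric]) auto
    finally show "1 = ?g i + taboo K (- A) (\<lambda>_. 1) i"
      by (simp add: taboo_def)
  qed
  have "?T n (\<lambda>_. 1) i = ?T n (\<lambda>i. ?g i + taboo K (- A) (\<lambda>_. 1) i) i" for n
    by (rule arg_cong[OF *])
  then have "?T n (\<lambda>_. 1) i = ?T n ?g i + ?T (Suc n) (\<lambda>_. 1) i" for n
    unfolding funpow_Suc_right o_apply by (simp only: taboo_pow_add)
  then show ?thesis
    unfolding green_def
    using telescoping_suminf_ennreal[of "\<lambda>n. ?T n (\<lambda>_. 1) i"] survival_tendsto_0[OF assms, of i] by simp
qed

text \<open>
  The functions \<open>(f - f j)\<^sup>+\<close> are subharmonic and integrable, hence harmonic, and they vanish at \<open>j\<close>.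
  So \<open>f \<le> f j\<close> for every \<open>j\<close>.
\<close>

lemma integrable_harmonic_const:
  fixes f :: "'s \<Rightarrow> real"
  assumes harm: "\<And>i. ((\<lambda>k. tmat K i k * f k) has_sum f i) UNIV"
    and int: "(\<lambda>i. pmf \<pi> i * \<bar>f i\<bar>) summable_on UNIV"
  shows "f i = f j"
proof -
  have le: "f i \<le> f j" for i j
  proof -
    let ?c = "f j" and ?p = "\<lambda>k. ennreal (f k - f j)"
    \<comment> \<open>harmonicity of the signed function gives subharmonicity of its positive part \<open>?p\<close>\<close>
    have "?p i \<le> (\<integral>\<^sup>+ k. ?p k \<partial>measure_pmf (K i))" for i
    proof -
      have "(\<integral>\<^sup>+ k. ennreal (tmat K i k) \<partial>count_space UNIV) = ennreal 1"
        using measure_pmf.emeasure_space_1[of "K i"] nn_integral_measure_pmf[of "K i" "\<lambda>_. 1"]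
        by (simp add: tmat_def)
      then have "(tmat K i has_sum 1) UNIV"
        by (intro has_sum_of_nn_integral) (auto simp: tmat_def)
      then have "((\<lambda>k. tmat K i k * f k + tmat K i k * - ?c) has_sum (f i + 1 * - ?c)) UNIV"
        by (intro has_sum_add harm has_sum_cmult_left)
      then have "ennreal (f i - ?c) \<le> (\<integral>\<^sup>+ k. ennreal (tmat K i k * (f k - ?c)) \<partial>count_space UNIV)"
        by (intro ennreal_sum_le_nn_integral) (simp add: algebra_simps)
      also have "\<dots> = (\<integral>\<^sup>+ k. ?p k \<partial>measure_pmf (K i))"
        unfolding nn_integral_measure_pmf
        by (intro nn_integral_cong) (simp add: tmat_def ennreal_mult')
      finally show ?thesis .
    qed
    moreover have "(\<integral>\<^sup>+ i. ?p i \<partial>measure_pmf \<pi>) < \<infinity>"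
    proof -
      have "(\<integral>\<^sup>+ i. ?p i \<partial>measure_pmf \<pi>) \<le> (\<integral>\<^sup>+ i. ennreal \<bar>f i\<bar> + ennreal \<bar>?c\<bar> \<partial>measure_pmf \<pi>)"
      proof (rule nn_integral_mono)
        fix i
        have "f i - ?c \<le> \<bar>f i\<bar> + \<bar>?c\<bar>"
          by linarith
        then show "?p i \<le> ennreal \<bar>f i\<bar> + ennreal \<bar>?c\<bar>"
          by (simp add: ennreal_leI flip: ennreal_plus)
      qed
      also have "\<dots> = (\<integral>\<^sup>+ i. ennreal (pmf \<pi> i * \<bar>f i\<bar>) \<partial>count_space UNIV) + ennreal \<bar>?c\<bar>"
        by (simp add: nn_integral_add nn_integral_measure_pmf[of \<pi> "\<lambda>i. ennreal \<bar>f i\<bar>"]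
            measure_pmf.emeasure_space_1 ennreal_mult)
      also have "\<dots> = ennreal (\<Sum>\<^sub>\<infinity>i. pmf \<pi> i * \<bar>f i\<bar>) + ennreal \<bar>?c\<bar>"
        using int by (subst nn_integral_of_has_sum[OF has_sum_infsum]) auto
      also have "\<dots> < \<infinity>" by simp
      finally show ?thesis .
    qed
    ultimately have "(\<integral>\<^sup>+ k. ?p k \<partial>measure_pmf (K i)) = ?p i" for i
      by (rule integrable_subharmonic_harmonic)
    then have "?p i = 0"
      by (intro superharmonic_zero[of ?p j i]) simp_all
    then show ?thesis by (simp add: ennreal_eq_0_iff)
  qed
  show ?thesis
    by (rule antisym[OF le le])
qed

lemma poisson_solution_unique:
  assumes X: "poisson_solution K \<pi> X" "pi_abs_finite \<pi> X"
    and Y: "poisson_solution K \<pi> Y" "pi_abs_finite \<pi> Y"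
  shows "X i n - Y i n = X j n - Y j n"
proof (rule integrable_harmonic_const)
  fix i
  let ?d = "\<lambda>k. X k n - Y k n"
  have "((\<lambda>k. (ident i k - tmat K i k) * X k n + - ((ident i k - tmat K i k) * Y k n)) has_sum
      ((ident i n - ones i * pmf \<pi> n) + - (ident i n - ones i * pmf \<pi> n))) UNIV"
    using X(1) Y(1) unfolding poisson_solution_def by (intro has_sum_add) (simp_all only: has_sum_uminus minus_minus)
  then have "((\<lambda>k. (ident i k - tmat K i k) * ?d k) has_sum 0) UNIV"
    by (simp add: right_diff_distrib)
  moreover have "((\<lambda>k. ident i k * ?d k) has_sum ?d i) UNIV"
    by (rule has_sum_finite_neutralI[of "{i}"]) (auto simp: ident_def)
  ultimately have "((\<lambda>k. ident i k * ?d k + - ((ident i k - tmat K i k) * ?d k)) has_sum (?d i + - 0)) UNIV"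
    by (intro has_sum_add) (simp_all only: has_sum_uminus minus_minus)
  then show "((\<lambda>k. tmat K i k * ?d k) has_sum ?d i) UNIV"
    by (simp add: left_diff_distrib)
next
  have "(\<lambda>i. pmf \<pi> i * \<bar>X i n\<bar> + pmf \<pi> i * \<bar>Y i n\<bar>) summable_on UNIV"
    using X(2) Y(2) unfolding pi_abs_finite_def by (intro summable_on_add) auto
  then show "(\<lambda>i. pmf \<pi> i * \<bar>X i n - Y i n\<bar>) summable_on UNIV"
    by (rule summable_on_comparison_test)
      (auto simp: abs_triangle_ineq4 intro!: mult_left_mono simp flip: distrib_left)
qed

end

section \<open>Expected return times and the Green operator\<close>

lemma measurable_chain_law_coord [measurable]:
  "(\<lambda>\<omega>. \<omega> k) \<in> measurable (chain_law K \<mu>) (count_space UNIV)"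
  unfolding measurable_cong_sets[OF sets_chain_law refl]
  by (rule measurable_component_singleton) simp

lemma sets_chain_law_cylinder [measurable]:
  "{\<omega>. \<forall>k\<le>n. \<omega> k = x k} \<in> sets (chain_law K \<mu>)"
proof -
  have "{\<omega> \<in> space (chain_law K \<mu>). \<forall>k\<in>{..n}. \<omega> k = x k} \<in> sets (chain_law K \<mu>)"
    by measurable
  then show ?thesis by (simp add: Ball_def)
qed

text \<open>
  The Markov property for an event \<open>Q\<close> that is determined by the path up to time \<open>n\<close>. Such an event is a countable
  disjoint union of cylinders, for which the step is visible in the finite-dimensional distributions. The words are
  represented by extensional functions on \<open>{..n}\<close>, so that distinct words give disjoint cylinders.
\<close>

lemma emeasure_chain_law_step:
  assumes past: "\<And>\<omega> \<omega>'. (\<And>k. k \<le> n \<Longrightarrow> \<omega> k = \<omega>' k) \<Longrightarrow> Q \<omega> \<longleftrightarrow> Q \<omega>'"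
  shows "emeasure (chain_law K \<mu>) {\<omega>. Q \<omega> \<and> \<omega> n = y \<and> \<omega> (Suc n) = j}
       = emeasure (chain_law K \<mu>) {\<omega>. Q \<omega> \<and> \<omega> n = y} * ennreal (pmf (K y) j)"
proof -
  define J where "J = {x \<in> PiE {..n} (\<lambda>_. UNIV). Q x \<and> x n = y}"
  let ?C = "\<lambda>x. {\<omega>. \<forall>k\<le>n. \<omega> k = x k}"
  let ?D = "\<lambda>x. {\<omega>. \<forall>k\<le>Suc n. \<omega> k = (x(Suc n := j)) k}"
  have "countable (PiE {..n} (\<lambda>_. UNIV :: 'a set))"
    by (intro countable_PiE) (auto simp: countableI_type)
  then have J: "countable J"
    unfolding J_def by (rule countable_subset[rotated]) auto
  have restr: "restrict \<omega> {..n} \<in> J \<longleftrightarrow> Q \<omega> \<and> \<omega> n = y" for \<omega>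
    using past[of "restrict \<omega> {..n}" \<omega>] by (simp add: J_def)
  have inJ: "x \<in> J \<Longrightarrow> (\<And>k. k \<le> n \<Longrightarrow> \<omega> k = x k) \<Longrightarrow> Q \<omega> \<and> \<omega> n = y" for x \<omega>
    using past[of \<omega> x] by (auto simp: J_def)
  have eqJ: "x = x'" if "x \<in> J" "x' \<in> J" "\<And>k. k \<le> n \<Longrightarrow> x k = x' k" for x x'
    using that unfolding J_def by (intro PiE_ext[of x "{..n}" "\<lambda>_. UNIV" x']) auto
  have disjC: "disjoint_family_on ?C J"
    unfolding disjoint_family_on_def
  proof (intro ballI impI)
    fix x x' assume "x \<in> J" "x' \<in> J" "x \<noteq> x'"
    then obtain k where "k \<le> n" "x k \<noteq> x' k"
      using eqJ by blast
    then show "?C x \<inter> ?C x' = {}" by auto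
  qed
  have sub: "?D x \<subseteq> ?C x" for x
  proof
    fix \<omega> assume \<omega>: "\<omega> \<in> ?D x"
    have "\<omega> k = x k" if "k \<le> n" for k
      using \<omega> that by (auto dest!: spec[of _ k])
    then show "\<omega> \<in> ?C x" by simp
  qed
  have disjD: "disjoint_family_on ?D J"
    unfolding disjoint_family_on_def
  proof (intro ballI impI)
    fix x x' assume "x \<in> J" "x' \<in> J" "x \<noteq> x'"
    then have "?C x \<inter> ?C x' = {}"
      by (rule disjoint_family_onD[OF disjC])
    moreover have "?D x \<inter> ?D x' \<subseteq> ?C x \<inter> ?C x'"
      by (rule Int_mono[OF sub sub])
    ultimately show "?D x \<inter> ?D x' = {}" by (simp only: subset_empty)
  qed
  have "{\<omega>. Q \<omega> \<and> \<omega> n = y} = (\<Union>x\<in>J. ?C x)"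
  proof (intro set_eqI iffI)
    fix \<omega> assume "\<omega> \<in> {\<omega>. Q \<omega> \<and> \<omega> n = y}"
    then show "\<omega> \<in> (\<Union>x\<in>J. ?C x)"
      using restr[of \<omega>] by (intro UN_I[of "restrict \<omega> {..n}"]) auto
  qed (auto dest: inJ)
  then have C: "emeasure (chain_law K \<mu>) {\<omega>. Q \<omega> \<and> \<omega> n = y}
      = (\<integral>\<^sup>+ x. emeasure (chain_law K \<mu>) (?C x) \<partial>count_space J)"
    using emeasure_UN_countable[OF _ J disjC, of "chain_law K \<mu>"] by simp
  have "{\<omega>. Q \<omega> \<and> \<omega> n = y \<and> \<omega> (Suc n) = j} = (\<Union>x\<in>J. ?D x)"
  proof (intro set_eqI iffI)
    fix \<omega> assume "\<omega> \<in> {\<omega>. Q \<omega> \<and> \<omega> n = y \<and> \<omega> (Suc n) = j}"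
    then show "\<omega> \<in> (\<Union>x\<in>J. ?D x)"
      using restr[of \<omega>] by (intro UN_I[of "restrict \<omega> {..n}"]) (auto simp: le_Suc_eq)
  next
    fix \<omega> assume "\<omega> \<in> (\<Union>x\<in>J. ?D x)"
    then obtain x where x: "x \<in> J" "\<omega> \<in> ?D x"
      by (rule UN_E)
    then have "\<omega> \<in> ?C x"
      by (intro subsetD[OF sub])
    then have "Q \<omega> \<and> \<omega> n = y"
      using inJ[OF x(1)] by simp
    moreover have "\<omega> (Suc n) = j"
      using x(2) by simp
    ultimately show "\<omega> \<in> {\<omega>. Q \<omega> \<and> \<omega> n = y \<and> \<omega> (Suc n) = j}"
      by simp
  qed
  then have "emeasure (chain_law K \<mu>) {\<omega>. Q \<omega> \<and> \<omega> n = y \<and> \<omega> (Suc n) = j}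
      = (\<integral>\<^sup>+ x. emeasure (chain_law K \<mu>) (?D x) \<partial>count_space J)"
    by (simp only: emeasure_UN_countable[OF sets_chain_law_cylinder J disjD])
  also have "\<dots> = (\<integral>\<^sup>+ x. emeasure (chain_law K \<mu>) (?C x) * ennreal (pmf (K y) j) \<partial>count_space J)"
  proof (intro nn_integral_cong)
    fix x assume "x \<in> space (count_space J)"
    then have "x n = y" by (simp add: J_def)
    then show "emeasure (chain_law K \<mu>) (?D x) = emeasure (chain_law K \<mu>) (?C x) * ennreal (pmf (K y) j)"
      unfolding emeasure_chain_law by (simp add: ennreal_mult prod_nonneg mult.assoc)
  qed
  also have "\<dots> = (\<integral>\<^sup>+ x. emeasure (chain_law K \<mu>) (?C x) \<partial>count_space J) * ennreal (pmf (K y) j)"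
    by (rule nn_integral_multc) simp
  finally show ?thesis unfolding C .
qed

lemma emeasure_chain_law_partition:
  assumes "\<And>y. {\<omega>. Q \<omega> \<and> \<omega> n = y} \<in> sets (chain_law K \<mu>)"
  shows "emeasure (chain_law K \<mu>) {\<omega>. Q \<omega>}
       = (\<integral>\<^sup>+ y. emeasure (chain_law K \<mu>) {\<omega>. Q \<omega> \<and> \<omega> n = y} \<partial>count_space UNIV)"
proof -
  have "{\<omega>. Q \<omega>} = (\<Union>y. {\<omega>. Q \<omega> \<and> \<omega> n = y})" by auto
  then show ?thesis
    using assms by (simp only:) (intro emeasure_UN_countable, auto simp: disjoint_family_on_def)
qed

text \<open>
  Duality between the law of the path killed outside \<open>B\<close>, which evolves by row vectors, and the iterated
  operator, which acts on functions. The weight \<open>f\<close> is arbitrary because the induction step replaces \<open>f\<close> by \<open>T f\<close>.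
\<close>

lemma chain_law_avoid_weighted:
  "(\<integral>\<^sup>+ y. emeasure (chain_law K \<mu>) {\<omega>. (\<forall>k\<in>{1..n}. \<omega> k \<in> B) \<and> \<omega> n = y} * f y \<partial>count_space UNIV)
     = (\<integral>\<^sup>+ i. (taboo K B ^^ n) f i \<partial>measure_pmf \<mu>)"
proof (induction n arbitrary: f)
  case 0
  have "{\<omega>. \<omega> (0::nat) = y} = {\<omega>. \<forall>k\<le>0. \<omega> k = (\<lambda>_. y) k}" for y :: 'a
    by auto
  then have "emeasure (chain_law K \<mu>) {\<omega>. \<omega> 0 = y} = ennreal (pmf \<mu> y)" for y
    by (simp only: emeasure_chain_law) simp
  then show ?case
    by (simp add: nn_integral_measure_pmf)
next
  case (Suc n)
  let ?L = "chain_law K \<mu>" and ?Q = "\<lambda>n \<omega>. \<forall>k\<in>{1..n}. \<omega> k \<in> B"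
  have step: "emeasure ?L {\<omega>. ?Q (Suc n) \<omega> \<and> \<omega> (Suc n) = j}
      = (\<integral>\<^sup>+ y. emeasure ?L {\<omega>. ?Q n \<omega> \<and> \<omega> n = y} * ennreal (pmf (K y) j) \<partial>count_space UNIV) * indicator B j" for j
  proof (cases "j \<in> B")
    case True
    have Q: "?Q (Suc n) \<omega> \<and> \<omega> (Suc n) = j \<longleftrightarrow> ?Q n \<omega> \<and> \<omega> (Suc n) = j" for \<omega>
      using True by (auto simp: le_Suc_eq)
    have "{\<omega> \<in> space ?L. (?Q n \<omega> \<and> \<omega> (Suc n) = j) \<and> \<omega> n = y} \<in> sets ?L" for y
      by measurable
    then have "emeasure ?L {\<omega>. ?Q (Suc n) \<omega> \<and> \<omega> (Suc n) = j}
        = (\<integral>\<^sup>+ y. emeasure ?L {\<omega>. (?Q n \<omega> \<and> \<omega> (Suc n) = j) \<and> \<omega> n = y} \<partial>count_space UNIV)"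
      unfolding Q by (intro emeasure_chain_law_partition) simp
    also have "\<dots> = (\<integral>\<^sup>+ y. emeasure ?L {\<omega>. ?Q n \<omega> \<and> \<omega> n = y} * ennreal (pmf (K y) j) \<partial>count_space UNIV)"
    proof (intro nn_integral_cong)
      fix y
      have "{\<omega>. (?Q n \<omega> \<and> \<omega> (Suc n) = j) \<and> \<omega> n = y} = {\<omega>. ?Q n \<omega> \<and> \<omega> n = y \<and> \<omega> (Suc n) = j}"
        by auto
      then show "emeasure ?L {\<omega>. (?Q n \<omega> \<and> \<omega> (Suc n) = j) \<and> \<omega> n = y}
          = emeasure ?L {\<omega>. ?Q n \<omega> \<and> \<omega> n = y} * ennreal (pmf (K y) j)"
        by (simp only:) (intro emeasure_chain_law_step, auto)
    qed
    finally show ?thesis using True by simp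
  next
    case False
    then have "{\<omega>. ?Q (Suc n) \<omega> \<and> \<omega> (Suc n) = j} = {}" by auto
    then show ?thesis using False by (simp only: emeasure_empty) simp
  qed
  have "(\<integral>\<^sup>+ j. emeasure ?L {\<omega>. ?Q (Suc n) \<omega> \<and> \<omega> (Suc n) = j} * f j \<partial>count_space UNIV)
      = (\<integral>\<^sup>+ j. \<integral>\<^sup>+ y. emeasure ?L {\<omega>. ?Q n \<omega> \<and> \<omega> n = y} * (ennreal (pmf (K y) j) * (f j * indicator B j))
          \<partial>count_space UNIV \<partial>count_space UNIV)"
    unfolding step
    by (intro nn_integral_cong) (simp add: mult_ac flip: nn_integral_multc nn_integral_cmult)
  also have "\<dots> = (\<integral>\<^sup>+ y. emeasure ?L {\<omega>. ?Q n \<omega> \<and> \<omega> n = y} * taboo K B f y \<partial>count_space UNIV)"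
    by (subst nn_integral_count_space_swap) (simp add: nn_integral_cmult taboo_def nn_integral_measure_pmf)
  also have "\<dots> = (\<integral>\<^sup>+ i. (taboo K B ^^ Suc n) f i \<partial>measure_pmf \<mu>)"
    unfolding Suc.IH by (simp add: funpow_swap1)
  finally show ?case .
qed

text \<open>
  The \<open>n\<close>-th indicator is \<open>1\<close> exactly if the return happens after time \<open>n\<close>; every visit time bounds the number of
  such \<open>n\<close>, and the return time is the infimum of the visit times.
\<close>

lemma sum_avoid_le_return_time:
  "(\<Sum>n. indicator {\<omega>. \<forall>k\<in>{1..n}. \<omega> k \<in> - {i}} \<omega>) \<le> return_time i \<omega>"
  unfolding return_time_def
proof (rule INF_greatest)
  fix k assume k: "k \<in> {k. 1 \<le> k \<and> \<omega> k = i}"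
  have "(\<Sum>n. indicator {\<omega>. \<forall>k\<in>{1..n}. \<omega> k \<in> - {i}} \<omega> :: ennreal)
      = (\<Sum>n<k. indicator {\<omega>. \<forall>k\<in>{1..n}. \<omega> k \<in> - {i}} \<omega>)"
    using k by (intro suminf_finite) (auto simp: indicator_def)
  also have "\<dots> \<le> (\<Sum>n<k. 1)"
    by (intro sum_mono) (auto simp: indicator_def)
  finally show "(\<Sum>n. indicator {\<omega>. \<forall>k\<in>{1..n}. \<omega> k \<in> - {i}} \<omega>) \<le> (of_nat k :: ennreal)"
    by simp
qed

lemma green_le_expected_return_time:
  "(\<integral>\<^sup>+ j. green K (- {i}) (\<lambda>_. 1) j \<partial>measure_pmf \<mu>) \<le> expected_return_time K \<mu> i"
proof -
  let ?L = "chain_law K \<mu>" and ?S = "\<lambda>n::nat. {\<omega>. \<forall>k\<in>{1..n}. \<omega> k \<in> - {i}}"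
  have "{\<omega> \<in> space ?L. \<forall>k\<in>{1..n}. \<omega> k \<in> - {i}} \<in> sets ?L" for n
    by measurable
  then have S [measurable]: "?S n \<in> sets ?L" for n by simp
  have "(\<integral>\<^sup>+ j. green K (- {i}) (\<lambda>_. 1) j \<partial>measure_pmf \<mu>)
      = (\<Sum>n. \<integral>\<^sup>+ j. (taboo K (- {i}) ^^ n) (\<lambda>_. 1) j \<partial>measure_pmf \<mu>)"
    unfolding green_def by (simp add: nn_integral_suminf)
  also have "\<dots> = (\<Sum>n. emeasure ?L (?S n))"
  proof (intro suminf_cong)
    fix n
    have "{\<omega> \<in> space ?L. (\<forall>k\<in>{1..n}. \<omega> k \<in> - {i}) \<and> \<omega> n = y} \<in> sets ?L" for y
      by measurable
    then show "(\<integral>\<^sup>+ j. (taboo K (- {i}) ^^ n) (\<lambda>_. 1) j \<partial>measure_pmf \<mu>) = emeasure ?L (?S n)"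
      by (subst emeasure_chain_law_partition[of _ n]) (simp_all flip: chain_law_avoid_weighted)
  qed
  also have "\<dots> = (\<integral>\<^sup>+ \<omega>. (\<Sum>n. indicator (?S n) \<omega>) \<partial>?L)"
    by (subst nn_integral_suminf) (simp_all only: borel_measurable_indicator[OF S] nn_integral_indicator[OF S])
  also have "\<dots> \<le> expected_return_time K \<mu> i"
    unfolding expected_return_time_def by (intro nn_integral_mono sum_avoid_le_return_time)
  finally show ?thesis .
qed

section \<open>Group inverses of finite matrices of corank one\<close>

text \<open>
  A square linear system with trivial kernel is solvable, by Gaussian elimination: pick a column and a row with a
  nonzero pivot and remove both. Rows and columns have separate index sets since the pivot need not be on the diagonal.
\<close>

lemma injective_system_solvable:
  fixes M :: "'r \<Rightarrow> 'c \<Rightarrow> real"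
  assumes "finite R" and "finite C" and "card R = card C"
    and "\<And>x j. (\<And>i. i \<in> R \<Longrightarrow> (\<Sum>j\<in>C. M i j * x j) = 0) \<Longrightarrow> j \<in> C \<Longrightarrow> x j = 0"
  shows "\<exists>x. \<forall>i\<in>R. (\<Sum>j\<in>C. M i j * x j) = b i"
  using assms
proof (induction "card C" arbitrary: R C M b)
  case 0
  then show ?case by auto
next
  case (Suc n)
  note inj = Suc.prems(4)
  obtain c where c: "c \<in> C"
    using Suc.hyps(2) by fastforce
  define C' where "C' = C - {c}"
  have C': "C = insert c C'" "c \<notin> C'" "finite C'" "card C' = n"
    using c Suc.hyps(2) Suc.prems(2) by (auto simp: C'_def)
  have sum_C: "(\<Sum>j\<in>C. f j) = f c + (\<Sum>j\<in>C'. f j)" for f :: "'c \<Rightarrow> real"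
    using C' by simp
  have "\<exists>r\<in>R. M r c \<noteq> 0"
  proof (rule ccontr)
    assume "\<not> (\<exists>r\<in>R. M r c \<noteq> 0)"
    then have M0: "M i c = 0" if "i \<in> R" for i
      using that by blast
    define e where "e j = (if j = c then 1 else 0 :: real)" for j
    have "(\<Sum>j\<in>C'. M i j * e j) = 0" for i
      using C'(2) by (intro sum.neutral) (auto simp: e_def)
    then have "(\<Sum>j\<in>C. M i j * e j) = 0" if "i \<in> R" for i
      unfolding sum_C using M0[OF that] by simp
    then have "e c = 0"
      using c by (rule inj)
    then show False by (simp add: e_def)
  qed
  then obtain r where r: "r \<in> R" "M r c \<noteq> 0" by blast
  define R' where "R' = R - {r}"
  have R': "R = insert r R'" "r \<notin> R'" "finite R'" "card R' = card C'"
    using r Suc.prems(1,3) Suc.hyps(2) C'(4) by (auto simp: R'_def)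
  \<comment> \<open>the Schur complement of the pivot\<close>
  define M' where "M' i j = M i j - M i c * M r j / M r c" for i j
  have elim: "(\<Sum>j\<in>C'. M' i j * x j) = (\<Sum>j\<in>C'. M i j * x j) - M i c * (\<Sum>j\<in>C'. M r j * x j) / M r c" for i x
    by (simp add: M'_def left_diff_distrib sum_subtractf sum_distrib_left sum_divide_distrib mult.assoc)
  have "\<exists>x. \<forall>i\<in>R'. (\<Sum>j\<in>C'. M' i j * x j) = b i - M i c * b r / M r c"
  proof (rule Suc.hyps(1)[OF C'(4)[symmetric] R'(3) C'(3) R'(4)])
    fix x j assume x: "\<And>i. i \<in> R' \<Longrightarrow> (\<Sum>j\<in>C'. M' i j * x j) = 0" and j: "j \<in> C'"
    define y where "y = x(c := - (\<Sum>j\<in>C'. M r j * x j) / M r c)"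
    have y: "(\<Sum>j\<in>C'. M i j * y j) = (\<Sum>j\<in>C'. M i j * x j)" for i
      using C'(2) by (intro sum.cong) (auto simp: y_def)
    have yc: "y c = - (\<Sum>j\<in>C'. M r j * x j) / M r c"
      by (simp add: y_def)
    have "y j = 0"
    proof (rule inj)
      fix i assume "i \<in> R"
      then show "(\<Sum>j\<in>C. M i j * y j) = 0"
        using x[of i] r(2) unfolding sum_C y yc R'(1) by (auto simp: elim)
    qed (use j C'(1) in simp)
    then show "x j = 0"
      using j C'(2) by (auto simp: y_def split: if_splits)
  qed
  then obtain x where x: "\<forall>i\<in>R'. (\<Sum>j\<in>C'. M' i j * x j) = b i - M i c * b r / M r c"
    by blast
  \<comment> \<open>back substitution through the pivot row\<close>
  define y where "y = x(c := (b r - (\<Sum>j\<in>C'. M r j * x j)) / M r c)"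
  have y: "(\<Sum>j\<in>C'. M i j * y j) = (\<Sum>j\<in>C'. M i j * x j)" for i
    using C'(2) by (intro sum.cong) (auto simp: y_def)
  have yc: "y c = (b r - (\<Sum>j\<in>C'. M r j * x j)) / M r c"
    by (simp add: y_def)
  have "(\<Sum>j\<in>C. M i j * y j) = b i" if "i \<in> R" for i
  proof (cases "i = r")
    case True
    then show ?thesis
      using r(2) unfolding sum_C y yc by simp
  next
    case False
    then have "(\<Sum>j\<in>C'. M i j * x j) = b i - M i c * b r / M r c + M i c * (\<Sum>j\<in>C'. M r j * x j) / M r c"
      using x that R'(1) elim[of i x] by force
    then show ?thesis
      unfolding sum_C y yc by (simp add: diff_divide_distrib right_diff_distrib)
  qed
  then show ?case by blast
qed

lemma mat_mult_finite: "finite S \<Longrightarrow> (X \<cdot>\<^bsub>S\<^esub> Y) i j = (\<Sum>k\<in>S. X i k * Y k j)"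
  by (simp add: mat_mult_def)

lemma mat_mult_assoc:
  assumes "finite A"
  shows "X \<cdot>\<^bsub>A\<^esub> Y \<cdot>\<^bsub>A\<^esub> Z = X \<cdot>\<^bsub>A\<^esub> (Y \<cdot>\<^bsub>A\<^esub> Z)"
proof (intro ext)
  fix i j
  have "(X \<cdot>\<^bsub>A\<^esub> Y \<cdot>\<^bsub>A\<^esub> Z) i j = (\<Sum>k\<in>A. \<Sum>l\<in>A. X i l * Y l k * Z k j)"
    using assms by (simp add: mat_mult_finite sum_distrib_right)
  also have "\<dots> = (\<Sum>l\<in>A. \<Sum>k\<in>A. X i l * (Y l k * Z k j))"
    by (subst sum.swap) (simp add: mult.assoc)
  finally show "(X \<cdot>\<^bsub>A\<^esub> Y \<cdot>\<^bsub>A\<^esub> Z) i j = (X \<cdot>\<^bsub>A\<^esub> (Y \<cdot>\<^bsub>A\<^esub> Z)) i j"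
    using assms by (simp add: mat_mult_finite sum_distrib_left)
qed

text \<open>
  Two group inverses \<open>G\<close> and \<open>G'\<close> give the same idempotent \<open>G W = W G = G' W = W G'\<close>, and then
  \<open>G = G' W G = G' W G' = G'\<close>. Cutting \<open>W\<close> down to \<open>A \<times> A\<close> turns the entrywise conditions into equations between
  functions.
\<close>

lemma group_inverse_unique:
  assumes A: "finite A" and G: "is_group_inverse A W G" and G': "is_group_inverse A W G'"
  shows "G = G'"
proof -
  define V where "V i j = (if i \<in> A \<and> j \<in> A then W i j else 0)" for i j
  note assoc = mat_mult_assoc[OF A]
  have V: "V \<cdot>\<^bsub>A\<^esub> (X \<cdot>\<^bsub>A\<^esub> V) = V" "X \<cdot>\<^bsub>A\<^esub> (V \<cdot>\<^bsub>A\<^esub> X) = X" "X \<cdot>\<^bsub>A\<^esub> V = V \<cdot>\<^bsub>A\<^esub> X"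
    if X: "is_group_inverse A W X" for X
  proof -
    have X0: "X i j = 0" if "i \<notin> A \<or> j \<notin> A" for i j
      using X that by (auto simp: is_group_inverse_def)
    have VX: "(V \<cdot>\<^bsub>A\<^esub> X) i j = (if i \<in> A \<and> j \<in> A then (W \<cdot>\<^bsub>A\<^esub> X) i j else 0)" for i j
      using A X0 by (auto simp: mat_mult_finite V_def)
    have XV: "(X \<cdot>\<^bsub>A\<^esub> V) i j = (if i \<in> A \<and> j \<in> A then (X \<cdot>\<^bsub>A\<^esub> W) i j else 0)" for i j
      using A X0 by (auto simp: mat_mult_finite V_def)
    have "(V \<cdot>\<^bsub>A\<^esub> X \<cdot>\<^bsub>A\<^esub> V) i j = (if i \<in> A \<and> j \<in> A then (W \<cdot>\<^bsub>A\<^esub> X \<cdot>\<^bsub>A\<^esub> W) i j else 0)" for i j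
      using A by (auto simp: mat_mult_finite[of A "V \<cdot>\<^bsub>A\<^esub> X"] mat_mult_finite[of A "W \<cdot>\<^bsub>A\<^esub> X"] VX V_def)
    then show "V \<cdot>\<^bsub>A\<^esub> (X \<cdot>\<^bsub>A\<^esub> V) = V"
      using X unfolding assoc[symmetric] by (auto simp: is_group_inverse_def V_def fun_eq_iff)
    have "(X \<cdot>\<^bsub>A\<^esub> V \<cdot>\<^bsub>A\<^esub> X) i j = (if i \<in> A \<and> j \<in> A then (X \<cdot>\<^bsub>A\<^esub> W \<cdot>\<^bsub>A\<^esub> X) i j else 0)" for i j
      using A by (auto simp: mat_mult_finite[of A "X \<cdot>\<^bsub>A\<^esub> V"] mat_mult_finite[of A "X \<cdot>\<^bsub>A\<^esub> W"] XV X0)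
    then show "X \<cdot>\<^bsub>A\<^esub> (V \<cdot>\<^bsub>A\<^esub> X) = X"
      using X X0 unfolding assoc[symmetric] by (auto simp: is_group_inverse_def fun_eq_iff)
    show "X \<cdot>\<^bsub>A\<^esub> V = V \<cdot>\<^bsub>A\<^esub> X"
      using X by (auto simp: fun_eq_iff VX XV is_group_inverse_def)
  qed
  have "G \<cdot>\<^bsub>A\<^esub> V = G \<cdot>\<^bsub>A\<^esub> (V \<cdot>\<^bsub>A\<^esub> (G' \<cdot>\<^bsub>A\<^esub> V))"
    by (simp only: V(1)[OF G'])
  also have "\<dots> = V \<cdot>\<^bsub>A\<^esub> (G \<cdot>\<^bsub>A\<^esub> V) \<cdot>\<^bsub>A\<^esub> G'"
    by (simp only: V(3)[OF G'] assoc[symmetric] V(3)[OF G, symmetric])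
  also have "\<dots> = V \<cdot>\<^bsub>A\<^esub> G'"
    by (simp only: V(1)[OF G])
  finally have E: "G \<cdot>\<^bsub>A\<^esub> V = G' \<cdot>\<^bsub>A\<^esub> V"
    by (simp only: V(3)[OF G'])
  have "G = G' \<cdot>\<^bsub>A\<^esub> V \<cdot>\<^bsub>A\<^esub> G"
    using V(2)[OF G] by (simp only: E[symmetric] assoc)
  also have "\<dots> = G' \<cdot>\<^bsub>A\<^esub> (G' \<cdot>\<^bsub>A\<^esub> V)"
    by (simp only: assoc V(3)[OF G, symmetric] E)
  also have "\<dots> = G'"
    using V(2)[OF G'] by (simp only: V(3)[OF G'])
  finally show ?thesis .
qed

text \<open>
  Let \<open>\<Pi>\<close> be the matrix whose rows all equal \<open>p\<close>. Since \<open>p W = 0\<close>, \<open>W e = 0\<close>, \<open>p e = 1\<close> and the kernel of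
  \<open>W\<close> consists of constants, \<open>W + \<Pi>\<close> is injective. If \<open>Z\<close> is its inverse, the group inverse is
  \<open>Z - \<Pi>\<close>, and \<open>W Z = Z W = I - \<Pi>\<close>.
\<close>

lemma group_inverse_exists:
  fixes p :: "'s \<Rightarrow> real"
  assumes A: "finite A"
    and left: "\<And>j. j \<in> A \<Longrightarrow> (\<Sum>i\<in>A. p i * W i j) = 0"
    and right: "\<And>i. i \<in> A \<Longrightarrow> (\<Sum>j\<in>A. W i j) = 0"
    and kernel: "\<And>x. (\<And>i. i \<in> A \<Longrightarrow> (\<Sum>j\<in>A. W i j * x j) = 0) \<Longrightarrow> \<exists>c. \<forall>j\<in>A. x j = c"
    and mass: "(\<Sum>i\<in>A. p i) = 1"
  obtains G where "is_group_inverse A W G"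
    and "\<And>i j. i \<in> A \<Longrightarrow> j \<in> A \<Longrightarrow> (W \<cdot>\<^bsub>A\<^esub> G) i j = ident i j - p j"
proof -
  have inj: "x j = 0" if x: "\<And>i. i \<in> A \<Longrightarrow> (\<Sum>j\<in>A. (W i j + p j) * x j) = 0" and "j \<in> A" for x j
  proof -
    let ?m = "\<Sum>j\<in>A. p j * x j"
    have *: "(\<Sum>j\<in>A. W i j * x j) = - ?m" if "i \<in> A" for i
      using x[OF that] by (simp add: distrib_right sum.distrib)
    have "- ?m = (\<Sum>i\<in>A. p i * - ?m)"
      unfolding sum_distrib_right[symmetric] mass by simp
    also have "\<dots> = (\<Sum>i\<in>A. p i * (\<Sum>j\<in>A. W i j * x j))"
      by (intro sum.cong) (auto simp: *)
    also have "\<dots> = (\<Sum>i\<in>A. \<Sum>j\<in>A. p i * W i j * x j)"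
      by (simp add: sum_distrib_left mult.assoc)
    also have "\<dots> = (\<Sum>j\<in>A. (\<Sum>i\<in>A. p i * W i j) * x j)"
      by (subst sum.swap) (simp add: sum_distrib_right)
    also have "\<dots> = 0" by (simp add: left)
    finally have m: "?m = 0" by simp
    then obtain c where c: "\<forall>j\<in>A. x j = c"
      using kernel[of x] * by auto
    then have "c * (\<Sum>i\<in>A. p i) = 0"
      using m by (simp add: sum_distrib_left mult.commute)
    then show ?thesis using mass c \<open>j \<in> A\<close> by simp
  qed
  have "\<exists>x. \<forall>i\<in>A. (\<Sum>k\<in>A. (W i k + p k) * x k) = ident i j" for j
    using inj by (intro injective_system_solvable[OF A A refl]) blast
  \<comment> \<open>\<open>z j\<close> is the column \<open>j\<close> of \<open>Z\<close>\<close>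
  then obtain z where z: "\<And>i j. i \<in> A \<Longrightarrow> (\<Sum>k\<in>A. (W i k + p k) * z j k) = ident i j"
    by metis
  have col: "(\<Sum>i\<in>A. p i * z j i) = p j" if "j \<in> A" for j
  proof -
    have "p j = (\<Sum>i\<in>A. p i * ident i j)"
      using that A by (simp add: ident_def if_distrib[of "\<lambda>x. _ * x"] cong: if_cong)
    also have "\<dots> = (\<Sum>i\<in>A. \<Sum>k\<in>A. p i * W i k * z j k + p i * (p k * z j k))"
      by (intro sum.cong refl) (simp add: z[symmetric] sum_distrib_left algebra_simps)
    also have "\<dots> = (\<Sum>k\<in>A. (\<Sum>i\<in>A. p i * W i k) * z j k) + (\<Sum>i\<in>A. p i) * (\<Sum>k\<in>A. p k * z j k)"
      unfolding sum.distrib sum_product by (subst sum.swap) (simp add: sum_distrib_right)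
    finally show ?thesis by (simp add: left mass)
  qed
  have Wz: "(\<Sum>k\<in>A. W i k * z j k) = ident i j - p j" if "i \<in> A" "j \<in> A" for i j
    using z[OF that(1), of j] col[OF that(2)] by (simp add: distrib_right sum.distrib)
  have zW: "(\<Sum>k\<in>A. z k i * W k j) = ident i j - p j" if "i \<in> A" "j \<in> A" for i j
  proof -
    define y where "y l = (\<Sum>k\<in>A. z k l * W k j) - (ident l j - p j)" for l
    have "y i = 0"
    proof (rule inj[OF _ that(1)])
      fix l assume l: "l \<in> A"
      have "(\<Sum>k\<in>A. (W l k + p k) * (\<Sum>m\<in>A. z m k * W m j)) = (\<Sum>m\<in>A. (\<Sum>k\<in>A. (W l k + p k) * z m k) * W m j)"
        unfolding sum_distrib_left sum_distrib_right by (subst sum.swap) (simp add: mult.assoc)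
      also have "\<dots> = W l j"
        using A l by (simp add: z ident_def if_distrib[of "\<lambda>x. x * _"] cong: if_cong)
      finally have 1: "(\<Sum>k\<in>A. (W l k + p k) * (\<Sum>m\<in>A. z m k * W m j)) = W l j" .
      have 2: "(\<Sum>k\<in>A. (W l k + p k) * ident k j) = W l j + p j"
        using A that(2) by (simp add: ident_def if_distrib[of "\<lambda>x. _ * x"] cong: if_cong)
      have 3: "(\<Sum>k\<in>A. (W l k + p k) * p j) = p j"
        using right[OF l] mass by (simp add: sum.distrib flip: sum_distrib_right)
      show "(\<Sum>k\<in>A. (W l k + p k) * y k) = 0"
        unfolding y_def right_diff_distrib sum_subtractf using 1 2 3 by (simp add: right_diff_distrib)
    qed
    then show ?thesis by (simp add: y_def)
  qed
  define G where "G i j = (if i \<in> A \<and> j \<in> A then z j i - p j else 0)" for i j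
  have WG: "(W \<cdot>\<^bsub>A\<^esub> G) i j = ident i j - p j" if "i \<in> A" "j \<in> A" for i j
    using that A Wz right[OF that(1)]
    by (simp add: mat_mult_finite G_def right_diff_distrib sum_subtractf flip: sum_distrib_right)
  have GW: "(G \<cdot>\<^bsub>A\<^esub> W) i j = ident i j - p j" if "i \<in> A" "j \<in> A" for i j
    using that A zW left[OF that(2)]
    by (simp add: mat_mult_finite G_def left_diff_distrib sum_subtractf)
  have "is_group_inverse A W G"
    unfolding is_group_inverse_def
  proof (intro conjI ballI allI impI)
    fix i j assume ij: "i \<in> A" "j \<in> A"
    show "(W \<cdot>\<^bsub>A\<^esub> G \<cdot>\<^bsub>A\<^esub> W) i j = W i j"
      using A ij left[OF ij(2)]
      by (simp add: mat_mult_finite[of A "W \<cdot>\<^bsub>A\<^esub> G"] WG left_diff_distrib sum_subtractf ident_def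
          if_distrib[of "\<lambda>x. x * _"] cong: if_cong)
    have "(\<Sum>k\<in>A. p k * (z j k - p j)) = 0"
      using col[OF ij(2)] mass by (simp add: right_diff_distrib sum_subtractf flip: sum_distrib_right)
    then show "(G \<cdot>\<^bsub>A\<^esub> W \<cdot>\<^bsub>A\<^esub> G) i j = G i j"
      using A ij
      by (simp add: mat_mult_finite[of A "G \<cdot>\<^bsub>A\<^esub> W"] GW left_diff_distrib sum_subtractf ident_def G_def
          if_distrib[of "\<lambda>x. x * _"] cong: if_cong)
    show "(G \<cdot>\<^bsub>A\<^esub> W) i j = (W \<cdot>\<^bsub>A\<^esub> G) i j"
      by (simp add: WG GW ij)
  qed (auto simp: G_def)
  then show thesis using that WG by blast
qed

text \<open>
  As \<open>W W\<^sup>#\<close> is the projection along the constants onto the vectors that \<open>p\<close> annihilates, \<open>W\<^sup># r\<close>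
  solves \<open>W x = r\<close> whenever \<open>p r = 0\<close>.
\<close>

lemma group_inverse_solves:
  fixes p r :: "'s \<Rightarrow> real"
  assumes A: "finite A"
    and left: "\<And>j. j \<in> A \<Longrightarrow> (\<Sum>i\<in>A. p i * W i j) = 0"
    and right: "\<And>i. i \<in> A \<Longrightarrow> (\<Sum>j\<in>A. W i j) = 0"
    and kernel: "\<And>x. (\<And>i. i \<in> A \<Longrightarrow> (\<Sum>j\<in>A. W i j * x j) = 0) \<Longrightarrow> \<exists>c. \<forall>j\<in>A. x j = c"
    and mass: "(\<Sum>i\<in>A. p i) \<noteq> 0"
    and r: "(\<Sum>i\<in>A. p i * r i) = 0"
    and i: "i \<in> A"
  shows "(\<Sum>j\<in>A. W i j * (\<Sum>k\<in>A. group_inverse A W j k * r k)) = r i"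
proof -
  define m where "m = (\<Sum>i\<in>A. p i)"
  obtain G where G: "is_group_inverse A W G"
    and WG: "\<And>i j. i \<in> A \<Longrightarrow> j \<in> A \<Longrightarrow> (W \<cdot>\<^bsub>A\<^esub> G) i j = ident i j - p j / m"
  proof (rule group_inverse_exists[OF A, where p = "\<lambda>i. p i / m" and W = W])
    show "(\<Sum>i\<in>A. p i / m * W i j) = 0" if "j \<in> A" for j
      using left[OF that] by (simp flip: sum_divide_distrib)
    show "(\<Sum>i\<in>A. p i / m) = 1"
      using mass by (simp add: m_def flip: sum_divide_distrib)
  qed (use right kernel in auto)
  have "group_inverse A W = G"
    unfolding group_inverse_def using G by (rule the_equality[where P = "is_group_inverse A W"]) (rule group_inverse_unique[OF A _ G])
  then have "(\<Sum>j\<in>A. W i j * (\<Sum>k\<in>A. group_inverse A W j k * r k)) = (\<Sum>k\<in>A. (\<Sum>j\<in>A. W i j * G j k) * r k)"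
    unfolding sum_distrib_left sum_distrib_right by (subst sum.swap) (simp add: mult.assoc)
  also have "\<dots> = (\<Sum>k\<in>A. (ident i k - p k / m) * r k)"
    using WG i A by (intro sum.cong) (auto simp: mat_mult_finite)
  also have "\<dots> = r i - (\<Sum>k\<in>A. p k * r k) / m"
    using A i by (simp add: left_diff_distrib sum_subtractf ident_def if_distrib[of "\<lambda>x. x * _"] sum_divide_distrib cong: if_cong)
  finally show ?thesis using r by simp
qed

section \<open>The censored chain and the solution of Poisson's equation\<close>

locale censored_chain = stationary_chain K \<pi>
  for K :: "'s::countable \<Rightarrow> 's pmf" and \<pi> :: "'s pmf" +
  fixes A :: "'s set"
  assumes finite_A: "finite A" and A_nonempty: "A \<noteq> {}"
begin

text \<open>
  The Green operator is needed as a real number too; the functions to which \<open>rgr\<close> is applied are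
  bounded by \<open>1\<close>, which makes the values finite. \<open>col a\<close> is the column \<open>a\<close> of the transition matrix, so \<open>gr (col a) i\<close> is the
  probability that the first return to \<open>A\<close> from \<open>i\<close> happens at \<open>a\<close>, if \<open>a \<in> A\<close>.
\<close>

abbreviation "tb \<equiv> taboo K (- A)"
abbreviation "gr \<equiv> green K (- A)"

abbreviation rgr :: "('s \<Rightarrow> ennreal) \<Rightarrow> 's \<Rightarrow> real" where
  "rgr f i \<equiv> enn2real (gr f i)"

abbreviation col :: "'s \<Rightarrow> 's \<Rightarrow> ennreal" where
  "col a i \<equiv> ennreal (pmf (K i) a)"

lemma green_finite:
  assumes "\<And>k. f k \<le> 1"
  shows "gr f i < \<top>"
proof -
  obtain a where "a \<in> A" using A_nonempty by blast
  then show ?thesis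
    using assms by (intro le_less_trans[OF green_mono green_one_finite])
qed

lemma taboo_green_le: "tb (gr f) i \<le> gr f i"
  using taboo_pow_green_le[where n = 1 and f = f] by simp

lemma taboo_green_finite:
  assumes "\<And>k. f k \<le> 1"
  shows "tb (gr f) i < \<top>"
  using taboo_green_le green_finite[where f = f, OF assms] by (rule le_less_trans)

lemma rgr_unfold:
  assumes "\<And>k. f k \<le> 1"
  shows "rgr f i = enn2real (f i) + enn2real (tb (gr f) i)"
proof -
  have "f i < \<top>" using assms[of i] by (simp add: le_less_trans)
  then show ?thesis
    using taboo_green_finite[where f = f and i = i, OF assms] by (subst green_unfold) (simp add: enn2real_plus)
qed

text \<open>
  The equation \<open>V f = f + T (V f)\<close> as a convergent real sum; every infinite sum in Poisson's equation is a
  finite linear combination of sums of this form.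
\<close>

lemma has_sum_taboo_green:
  assumes "\<And>k. f k \<le> 1"
  shows "((\<lambda>k. tmat K i k * rgr f k) has_sum (rgr f i - enn2real (f i))) (- A)"
proof -
  have "((\<lambda>k. tmat K i k * rgr f k) has_sum enn2real (tb (gr f) i)) (- A)"
    by (rule has_sum_enn2real[OF _ _ taboo_green_finite[where f = f, OF assms]])
      (simp_all add: taboo_count_space[of _ _ "gr f"] enn2real_mult tmat_def)
  then show ?thesis using rgr_unfold[where f = f and i = i, OF assms] by simp
qed

text \<open>
  The path stops before it returns to \<open>A\<close>, so only a visit at time \<open>0\<close> counts. This is why the blocks \<open>I\<close> and
  \<open>O\<close> of the statement are values of the Green operator.
\<close>

lemma gr_indicator_A:
  assumes "n \<in> A"
  shows "gr (indicator {n}) i = indicator {n} i"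
proof -
  have "tb (gr (indicator {n})) i = tb (\<lambda>_. 0) i"
  proof (rule taboo_cong)
    fix k assume "k \<in> - A"
    then show "gr (indicator {n}) k = 0"
      using assms green_cong[of "- A" "indicator {n}" "\<lambda>_. 0" k K]
      by (auto simp: green_def indicator_def)
  qed
  then show ?thesis
    by (subst green_unfold) (simp add: taboo_def)
qed

lemma hat_P_eq:
  assumes "i \<in> - A" and "j \<in> - A"
  shows "hat_P K (- A) i j = rgr (indicator {j}) i"
proof -
  let ?t = "\<lambda>n. (tb ^^ n) (indicator {j}) i"
  have fin: "gr (indicator {j}) i < \<top>"
    by (intro green_finite) (simp add: indicator_def)
  then have "?t n < \<top>" for n
    using taboo_pow_le_green by (rule le_less_trans[rotated])
  then have *: "(\<Sum>n. ennreal (enn2real (?t n))) = gr (indicator {j}) i"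
    unfolding green_def by simp
  then have "summable (\<lambda>n. enn2real (?t n))"
    using fin by (intro summable_suminf_not_top) auto
  then have "enn2real (\<Sum>n. ennreal (enn2real (?t n))) = (\<Sum>n. enn2real (?t n))"
    by (subst suminf_ennreal2) (simp_all add: suminf_nonneg)
  then show ?thesis
    unfolding hat_P_def * by (simp add: mat_pow_taboo[OF assms])
qed

lemma P_hat_P_eq:
  assumes "n \<in> - A"
  shows "(tmat K \<cdot>\<^bsub>- A\<^esub> hat_P K (- A)) i n = enn2real (tb (gr (indicator {n})) i)"
  by (rule mat_mult_enn2real[where x = "\<lambda>k. col k i" and y = "gr (indicator {n})"])
    (use assms in \<open>simp_all add: tmat_def hat_P_eq taboo_green_finite split: split_indicator
      flip: taboo_count_space[of _ _ "gr _"]\<close>)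

lemma P_hat_P_P_eq:
  "(tmat K \<cdot>\<^bsub>- A\<^esub> hat_P K (- A) \<cdot>\<^bsub>- A\<^esub> tmat K) i a = enn2real (tb (gr (col a)) i)"
  by (rule mat_mult_enn2real[OF _ _ taboo_green_kernel])
    (simp_all add: tmat_def P_hat_P_eq taboo_green_finite pmf_le_1)

lemma hat_P_P_eq:
  assumes "i \<in> - A"
  shows "(hat_P K (- A) \<cdot>\<^bsub>- A\<^esub> tmat K) i a = rgr (col a) i"
  by (rule mat_mult_enn2real[OF _ _ green_kernel])
    (use assms in \<open>simp_all add: tmat_def hat_P_eq green_finite pmf_le_1\<close>)

lemma mat_vec_hat_P_eq:
  assumes "i \<in> - A"
  shows "mat_vec (hat_P K (- A)) (- A) ones i = rgr (\<lambda>_. 1) i"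
  unfolding mat_vec_def using assms green_kernel[OF assms, where K = K and f = "\<lambda>_. 1"]
  by (intro infsumI has_sum_enn2real) (simp_all add: hat_P_eq ones_def green_finite)

lemma mat_vec_P_hat_P_eq:
  "mat_vec (tmat K \<cdot>\<^bsub>- A\<^esub> hat_P K (- A)) (- A) ones i = enn2real (tb (gr (\<lambda>_. 1)) i)"
  unfolding mat_vec_def using taboo_green_kernel[where K = K and B = "- A" and i = i and f = "\<lambda>_. 1"]
  by (intro infsumI has_sum_enn2real) (simp_all add: P_hat_P_eq ones_def taboo_green_finite)

lemma censored_eq: "censored K A i a = rgr (col a) i"
  unfolding censored_def P_hat_P_P_eq
  by (subst rgr_unfold) (simp_all add: tmat_def pmf_le_1)

lemma rgr_stationary:
  assumes "\<And>k. f k \<le> 1"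
  shows "(\<Sum>i\<in>A. pmf \<pi> i * rgr f i) = enn2real (\<integral>\<^sup>+ i. f i \<partial>measure_pmf \<pi>)"
proof -
  obtain a where a: "a \<in> A" using A_nonempty by blast
  have "(\<integral>\<^sup>+ i. f i \<partial>measure_pmf \<pi>) = (\<integral>\<^sup>+ i. gr f i * indicator A i \<partial>measure_pmf \<pi>)"
    using green_stationary[OF a assms] by simp
  also have "\<dots> = (\<integral>\<^sup>+ i. ennreal (pmf \<pi> i) * gr f i \<partial>count_space A)"
    unfolding nn_integral_measure_pmf
    by (subst nn_integral_count_space_indicator[of A]) (auto simp: mult_ac)
  also have "\<dots> = (\<Sum>i\<in>A. ennreal (pmf \<pi> i) * gr f i)"
    by (rule nn_integral_count_space_finite[OF finite_A])
  also have "enn2real \<dots> = (\<Sum>i\<in>A. pmf \<pi> i * rgr f i)"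
    using green_finite[where f = f, OF assms] by (subst enn2real_sum) (auto simp: enn2real_mult ennreal_mult_less_top)
  finally show ?thesis by simp
qed

lemma rgr_col_sum: "(\<Sum>a\<in>A. rgr (col a) i) = 1"
proof -
  obtain a where a: "a \<in> A" using A_nonempty by blast
  have "(\<Sum>a\<in>A. gr (col a) i) = gr (\<lambda>i. emeasure (measure_pmf (K i)) A) i"
    using finite_A by (simp add: emeasure_measure_pmf_finite green_sum sum_nonneg flip: sum_ennreal)
  also have "\<dots> = 1" by (rule green_exit_eq_1[OF a])
  finally have "enn2real (\<Sum>a\<in>A. gr (col a) i) = 1" by simp
  then show ?thesis
    using green_finite by (subst (asm) enn2real_sum) (auto simp: pmf_le_1)
qed

lemma nn_integral_row_split:
  "(\<integral>\<^sup>+ k. f k \<partial>measure_pmf (K i)) = (\<Sum>a\<in>A. col a i * f a) + tb f i"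
proof -
  have "(\<integral>\<^sup>+ k. f k \<partial>measure_pmf (K i))
      = (\<integral>\<^sup>+ k. f k * indicator A k \<partial>measure_pmf (K i)) + tb f i"
    unfolding taboo_def by (subst nn_integral_add[symmetric]) (auto simp: indicator_def intro!: nn_integral_cong)
  also have "(\<integral>\<^sup>+ k. f k * indicator A k \<partial>measure_pmf (K i)) = (\<integral>\<^sup>+ k. col k i * f k \<partial>count_space A)"
    unfolding nn_integral_measure_pmf
    by (subst nn_integral_count_space_indicator[of A]) (auto simp: mult_ac)
  finally show ?thesis
    by (simp add: nn_integral_count_space_finite[OF finite_A])
qed

text \<open>
  Maximum principle. Let \<open>M\<close> be the maximum of \<open>x\<close>, attained at \<open>b\<close>. The function
  \<open>V (\<Sum>j. (M - x j) p\<^sub>j)\<close> extends \<open>M - x\<close> from \<open>A\<close> to all states, is nonnegative and harmonic for the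
  original chain, and vanishes at \<open>b\<close>, so it is zero by irreducibility of that chain.
\<close>

lemma censored_harmonic_const:
  assumes x: "\<And>i. i \<in> A \<Longrightarrow> (\<Sum>j\<in>A. rgr (col j) i * x j) = x i"
  shows "\<exists>c. \<forall>j\<in>A. x j = c"
proof -
  define M where "M = Max (x ` A)"
  have "M \<in> x ` A"
    unfolding M_def using finite_A A_nonempty by (intro Max_in) auto
  then obtain b where b: "b \<in> A" "x b = M" by auto
  have le_M: "x j \<le> M" if "j \<in> A" for j
    using that finite_A by (simp add: M_def)
  define F where "F i = (\<Sum>j\<in>A. ennreal (M - x j) * col j i)" for i
  have gF: "gr F i = ennreal (M - x i)" if "i \<in> A" for i
  proof -
    have "gr F i = (\<Sum>j\<in>A. ennreal (M - x j) * gr (col j) i)"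
      unfolding F_def using finite_A by (simp add: green_sum green_cmult)
    also have "\<dots> = (\<Sum>j\<in>A. ennreal ((M - x j) * rgr (col j) i))"
      using le_M green_finite[of "col _"] by (intro sum.cong) (auto simp: ennreal_mult pmf_le_1)
    also have "\<dots> = ennreal (\<Sum>j\<in>A. (M - x j) * rgr (col j) i)"
      using le_M by (intro sum_ennreal) simp
    also have "(\<Sum>j\<in>A. (M - x j) * rgr (col j) i) = M * (\<Sum>j\<in>A. rgr (col j) i) - (\<Sum>j\<in>A. rgr (col j) i * x j)"
      by (simp add: left_diff_distrib sum_subtractf sum_distrib_left mult.commute)
    finally show ?thesis by (simp add: rgr_col_sum x that)
  qed
  have "(\<integral>\<^sup>+ k. gr F k \<partial>measure_pmf (K i)) = gr F i" for i
  proof -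
    have "(\<Sum>a\<in>A. col a i * gr F a) = F i"
      unfolding F_def[of i] by (intro sum.cong) (auto simp: gF mult.commute)
    then show ?thesis
      unfolding nn_integral_row_split green_unfold[of K "- A" F i] by simp
  qed
  moreover have "gr F b = 0"
    using gF[OF b(1)] b(2) by simp
  ultimately have "gr F i = 0" for i
    by (intro superharmonic_zero[of "gr F" b i]) simp_all
  then have "x j = M" if "j \<in> A" for j
    using gF[OF that] le_M[OF that] by simp
  then show ?thesis by blast
qed

text \<open>
  On the rows in \<open>A\<close> this is the matrix that the group inverse multiplies; the same formula continues it to all rows.
\<close>

definition forcing :: "'s \<Rightarrow> 's \<Rightarrow> real" where
  "forcing i n = rgr (indicator {n}) i - rgr (\<lambda>_. 1) i * pmf \<pi> n"

lemma rgr_one_unfold: "rgr (\<lambda>_. 1) i = 1 + enn2real (tb (gr (\<lambda>_. 1)) i)"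
  by (subst rgr_unfold) auto

lemma X_A_eq:
  "X_A K \<pi> A i n = (\<Sum>k\<in>A. group_inverse A (\<lambda>i j. ident i j - rgr (col j) i) i k * forcing k n)"
  unfolding X_A_def Let_def mat_mult_finite[OF finite_A] censored_eq
proof (intro sum.cong refl arg_cong2[where f = "(*)"])
  fix k assume k: "k \<in> A"
  have "rgr (indicator {n}) k = (if n \<in> A then ident k n else (tmat K \<cdot>\<^bsub>- A\<^esub> hat_P K (- A)) k n)"
  proof (cases "n \<in> A")
    case False
    then have "enn2real (indicator {n} k) = 0"
      using k by (auto simp: indicator_def)
    then show ?thesis
      using False by (subst rgr_unfold) (auto simp: P_hat_P_eq indicator_def)
  qed (simp add: gr_indicator_A ident_def indicator_def)
  then show "(if n \<in> A then ident k n else (tmat K \<cdot>\<^bsub>- A\<^esub> hat_P K (- A)) k n)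
      - (ones k + mat_vec (tmat K \<cdot>\<^bsub>- A\<^esub> hat_P K (- A)) (- A) ones k) * pmf \<pi> n = forcing k n"
    by (simp add: forcing_def mat_vec_P_hat_P_eq rgr_one_unfold ones_def)
qed

text \<open>
  The left null vector of \<open>I - P\<^sup>A\<close> is \<open>\<pi>\<close> on \<open>A\<close>. All conditions on it come from Kac's formula:
  with \<open>f\<close> a column of \<open>P\<close> it is invariance, and with \<open>f = \<delta>\<^sub>n\<close> and \<open>f = 1\<close> it is the solvability condition
  \<open>\<pi>\<^sub>A R = 0\<close>.
\<close>

lemma X_A_solves:
  assumes "i \<in> A"
  shows "X_A K \<pi> A i n = (\<Sum>a\<in>A. rgr (col a) i * X_A K \<pi> A a n) + forcing i n"
proof -
  let ?W = "\<lambda>i j. ident i j - rgr (col j) i"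
  have id: "(\<Sum>j\<in>A. ident i j * f j) = f i" "(\<Sum>j\<in>A. f j * ident j i) = f i" if "i \<in> A" for f :: "'s \<Rightarrow> real" and i
  proof -
    have "(\<Sum>j\<in>A. ident i j * f j) = (\<Sum>j\<in>A. if j = i then f j else 0)"
      by (intro sum.cong) (auto simp: ident_def)
    then show "(\<Sum>j\<in>A. ident i j * f j) = f i"
      using that finite_A by simp
    have "(\<Sum>j\<in>A. f j * ident j i) = (\<Sum>j\<in>A. if j = i then f j else 0)"
      by (intro sum.cong) (auto simp: ident_def)
    then show "(\<Sum>j\<in>A. f j * ident j i) = f i"
      using that finite_A by simp
  qed
  have ones: "(\<Sum>j\<in>A. ident i j) = 1" if "i \<in> A" for i
    using id(1)[OF that, of "\<lambda>_. 1"] by simp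
  have "(\<Sum>j\<in>A. ?W i j * (\<Sum>k\<in>A. group_inverse A ?W j k * forcing k n)) = forcing i n"
  proof (rule group_inverse_solves[OF finite_A _ _ _ _ _ assms, where p = "pmf \<pi>"])
    show "(\<Sum>i\<in>A. pmf \<pi> i * ?W i j) = 0" if "j \<in> A" for j
    proof -
      have "(\<Sum>i\<in>A. pmf \<pi> i * rgr (col j) i) = pmf \<pi> j"
        by (subst rgr_stationary) (simp_all add: pmf_le_1 bind_invariant flip: ennreal_pmf_bind)
      then show ?thesis
        using id(2)[OF that, of "pmf \<pi>"] by (simp add: right_diff_distrib sum_subtractf)
    qed
    show "(\<Sum>j\<in>A. ?W i j) = 0" if "i \<in> A" for i
      using ones[OF that] by (simp add: sum_subtractf rgr_col_sum)
    show "\<exists>c. \<forall>j\<in>A. x j = c" if "\<And>i. i \<in> A \<Longrightarrow> (\<Sum>j\<in>A. ?W i j * x j) = 0" for x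
      using that id(1)[of _ x] by (intro censored_harmonic_const) (simp add: left_diff_distrib sum_subtractf)
    show "(\<Sum>i\<in>A. pmf \<pi> i) \<noteq> 0"
      using sum_pos[OF finite_A A_nonempty, of "pmf \<pi>"] pi_pos by force
    have "(\<Sum>i\<in>A. pmf \<pi> i * rgr (indicator {n}) i) = pmf \<pi> n"
      by (subst rgr_stationary) (simp_all add: emeasure_pmf_single split: split_indicator)
    moreover have "(\<Sum>i\<in>A. pmf \<pi> i * rgr (\<lambda>_. 1) i) = 1"
      by (subst rgr_stationary) (simp_all add: measure_pmf.emeasure_space_1)
    ultimately show "(\<Sum>i\<in>A. pmf \<pi> i * forcing i n) = 0"
      by (simp add: forcing_def right_diff_distrib sum_subtractf mult.assoc[symmetric] flip: sum_distrib_right)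
  qed
  then have "(\<Sum>j\<in>A. ?W i j * X_A K \<pi> A j n) = forcing i n"
    by (simp only: X_A_eq)
  then show ?thesis
    using id(1)[OF assms, of "\<lambda>j. X_A K \<pi> A j n"] by (simp add: left_diff_distrib sum_subtractf)
qed

text \<open>
  On the rows in \<open>B\<close> this is the definition of the second block; on the rows in \<open>A\<close> it is the linear system that the
  first block solves.
\<close>

lemma X_tilde_eq:
  "X_tilde K \<pi> A i n = (\<Sum>a\<in>A. rgr (col a) i * X_A K \<pi> A a n) + forcing i n"
proof (cases "i \<in> A")
  case True
  then show ?thesis using X_A_solves by (simp add: X_tilde_def)
next
  case False
  then have i: "i \<in> - A" by simp
  have "(if n \<in> A then 0 else hat_P K (- A) i n) = rgr (indicator {n}) i"
    using i by (auto simp: gr_indicator_A hat_P_eq indicator_def)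
  then show ?thesis
    using False i
    by (simp add: X_tilde_def X_B_def Let_def mat_mult_finite[OF finite_A, of _ "X_A K \<pi> A"] hat_P_P_eq
        mat_vec_hat_P_eq forcing_def)
qed

text \<open>
  On \<open>B\<close> the representation of \<open>X\<close> by the Green operator is summed term by term; what the subtracted terms leave out,
  namely \<open>\<Sum>a\<in>A. P(i,a) X\<^sub>A(a,n)\<close>, is the sum over \<open>A\<close>.
\<close>

lemma has_sum_P_X_tilde:
  "((\<lambda>k. tmat K i k * X_tilde K \<pi> A k n) has_sum (X_tilde K \<pi> A i n - ident i n + pmf \<pi> n)) UNIV"
proof -
  let ?X = "X_A K \<pi> A" and ?P = "tmat K i"
  have "((\<lambda>k. (\<Sum>a\<in>A. (?P k * rgr (col a) k) * ?X a n)
          + (?P k * rgr (indicator {n}) k + (?P k * rgr (\<lambda>_. 1) k) * - pmf \<pi> n)) has_sum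
        ((\<Sum>a\<in>A. (rgr (col a) i - enn2real (col a i)) * ?X a n)
          + ((rgr (indicator {n}) i - enn2real (indicator {n} i)) + (rgr (\<lambda>_. 1) i - enn2real 1) * - pmf \<pi> n))) (- A)"
    by (intro has_sum_add has_sum_sum_finite has_sum_cmult_left has_sum_taboo_green finite_A)
      (auto simp: pmf_le_1 indicator_def)
  moreover have "(\<Sum>a\<in>A. (?P k * rgr (col a) k) * ?X a n)
          + (?P k * rgr (indicator {n}) k + (?P k * rgr (\<lambda>_. 1) k) * - pmf \<pi> n) = ?P k * X_tilde K \<pi> A k n" for k
    by (simp add: X_tilde_eq forcing_def distrib_left right_diff_distrib sum_distrib_left mult.assoc)
  moreover have "((\<Sum>a\<in>A. (rgr (col a) i - enn2real (col a i)) * ?X a n)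
          + ((rgr (indicator {n}) i - enn2real (indicator {n} i)) + (rgr (\<lambda>_. 1) i - enn2real 1) * - pmf \<pi> n))
      = X_tilde K \<pi> A i n - ident i n + pmf \<pi> n - (\<Sum>a\<in>A. ?P a * ?X a n)"
    by (simp add: X_tilde_eq[of i] forcing_def ident_def tmat_def left_diff_distrib sum_subtractf indicator_def)
  ultimately have "((\<lambda>k. ?P k * X_tilde K \<pi> A k n) has_sum
      (X_tilde K \<pi> A i n - ident i n + pmf \<pi> n - (\<Sum>a\<in>A. ?P a * ?X a n))) (- A)"
    by simp
  moreover have "((\<lambda>k. ?P k * X_tilde K \<pi> A k n) has_sum (\<Sum>a\<in>A. ?P a * ?X a n)) A"
    by (rule has_sum_finiteI[OF finite_A]) (simp add: X_tilde_def)
  ultimately have "((\<lambda>k. ?P k * X_tilde K \<pi> A k n) has_sum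
      ((X_tilde K \<pi> A i n - ident i n + pmf \<pi> n - (\<Sum>a\<in>A. ?P a * ?X a n)) + (\<Sum>a\<in>A. ?P a * ?X a n))) (- A \<union> A)"
    by (rule has_sum_Un_disjoint) auto
  then show ?thesis by simp
qed

lemma poisson_solution_X_tilde:
  "poisson_solution K \<pi> (X_tilde K \<pi> A)"
  unfolding poisson_solution_def
proof (intro allI)
  fix i n
  let ?X = "X_tilde K \<pi> A"
  have "((\<lambda>k. ident i k * ?X k n) has_sum ?X i n) UNIV"
    by (rule has_sum_finite_neutralI[of "{i}"]) (auto simp: ident_def)
  then have "((\<lambda>k. ident i k * ?X k n + - (tmat K i k * ?X k n)) has_sum
      (?X i n + - (?X i n - ident i n + pmf \<pi> n))) UNIV"
    using has_sum_P_X_tilde[of i n] by (intro has_sum_add) (simp_all only: has_sum_uminus minus_minus)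
  then show "((\<lambda>k. (ident i k - tmat K i k) * ?X k n) has_sum (ident i n - ones i * pmf \<pi> n)) UNIV"
    by (simp add: left_diff_distrib ones_def)
qed

text \<open>
  The Green operator at any function bounded by \<open>1\<close> is at most \<open>V 1\<close>, so \<open>V 1\<close> dominates the solution up to a factor
  that depends only on the column, and \<open>V 1\<close> is integrable.
\<close>

lemma pi_abs_finite_X_tilde:
  assumes "expected_return_time K \<pi> j < \<infinity>"
  shows "pi_abs_finite \<pi> (X_tilde K \<pi> A)"
  unfolding pi_abs_finite_def
proof
  fix n
  let ?u = "rgr (\<lambda>_. 1)"
  \<comment> \<open>the summand \<open>2\<close> accounts for the two terms of the forcing matrix\<close>
  define c where "c = (\<Sum>a\<in>A. \<bar>X_A K \<pi> A a n\<bar>) + 2"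
  have fin: "gr (\<lambda>_. 1) i < \<top>" for i
    by (rule green_finite) simp
  have "(\<integral>\<^sup>+ i. gr (\<lambda>_. 1) i \<partial>measure_pmf \<pi>)
      \<le> (\<integral>\<^sup>+ i. green K (- {j}) (\<lambda>_. 1) i + gr (\<lambda>_. 1) j \<partial>measure_pmf \<pi>)"
    by (intro nn_integral_mono green_one_le_add)
  also have "\<dots> = (\<integral>\<^sup>+ i. green K (- {j}) (\<lambda>_. 1) i \<partial>measure_pmf \<pi>) + gr (\<lambda>_. 1) j"
    by (simp add: nn_integral_add measure_pmf.emeasure_space_1)
  also have "\<dots> < \<top>"
    using green_le_expected_return_time[of \<pi> K j] assms fin[of j] by (simp add: le_less_trans)
  finally have "((\<lambda>i. pmf \<pi> i * ?u i) has_sum enn2real (\<integral>\<^sup>+ i. gr (\<lambda>_. 1) i \<partial>measure_pmf \<pi>)) UNIV"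
    unfolding nn_integral_measure_pmf[of \<pi> "gr (\<lambda>_. 1)"]
    by (intro has_sum_enn2real[OF _ refl]) (simp_all add: enn2real_mult)
  then have "((\<lambda>i. pmf \<pi> i * ?u i * c) has_sum (enn2real (\<integral>\<^sup>+ i. gr (\<lambda>_. 1) i \<partial>measure_pmf \<pi>) * c)) UNIV"
    by (rule has_sum_cmult_left)
  then have "(\<lambda>i. pmf \<pi> i * ?u i * c) summable_on UNIV"
    by (rule has_sum_imp_summable)
  then show "(\<lambda>i. pmf \<pi> i * \<bar>X_tilde K \<pi> A i n\<bar>) summable_on UNIV"
  proof (rule summable_on_comparison_test)
    fix i
    have mono: "rgr f i \<le> ?u i" if "\<And>k. f k \<le> 1" for f
      using green_mono[of f "\<lambda>_. 1"] that fin by (intro enn2real_mono) auto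
    have "\<bar>\<Sum>a\<in>A. rgr (col a) i * X_A K \<pi> A a n\<bar> \<le> (\<Sum>a\<in>A. \<bar>rgr (col a) i * X_A K \<pi> A a n\<bar>)"
      by (rule sum_abs)
    also have "\<dots> \<le> (\<Sum>a\<in>A. ?u i * \<bar>X_A K \<pi> A a n\<bar>)"
      unfolding abs_mult by (intro sum_mono mult_right_mono) (auto intro!: mono simp: pmf_le_1)
    finally have 1: "\<bar>\<Sum>a\<in>A. rgr (col a) i * X_A K \<pi> A a n\<bar> \<le> ?u i * (\<Sum>a\<in>A. \<bar>X_A K \<pi> A a n\<bar>)"
      by (simp add: sum_distrib_left)
    have 2: "rgr (indicator {n}) i \<le> ?u i"
      by (rule mono) (simp split: split_indicator)
    have 3: "?u i * pmf \<pi> n \<le> ?u i" "0 \<le> ?u i * pmf \<pi> n"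
      by (simp_all add: mult_left_le pmf_le_1)
    have "\<bar>X_tilde K \<pi> A i n\<bar> \<le> ?u i * c"
      using 1 2 3 enn2real_nonneg[of "gr (indicator {n}) i"]
      unfolding X_tilde_eq[of i n] forcing_def c_def distrib_left by linarith
    then show "pmf \<pi> i * \<bar>X_tilde K \<pi> A i n\<bar> \<le> pmf \<pi> i * ?u i * c"
      by (simp add: mult_left_mono mult.assoc)
  qed simp
qed

end

theorem theorem3p1:
  fixes K :: "'s::countable \<Rightarrow> 's pmf" and \<pi> :: "'s pmf" and A :: "'s set"
  assumes "irreducible_chain K" and "positive_recurrent K"
    and "invariant_pmf K \<pi>"
    and "finite A" and "A \<noteq> {}"
  shows "poisson_solution K \<pi> (X_tilde K \<pi> A) \<and>
    ((\<exists>i. expected_return_time K \<pi> i < \<infinity>) \<longrightarrow>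
       pi_abs_finite \<pi> (X_tilde K \<pi> A) \<and>
       (\<forall>X. poisson_solution K \<pi> X \<and> pi_abs_finite \<pi> X \<longrightarrow>
          (\<exists>\<beta> :: 's \<Rightarrow> real. \<forall>i n. X i n = X_tilde K \<pi> A i n + ones i * \<beta> n)))"
proof -
  interpret censored_chain K \<pi> A
    by unfold_locales (use assms in auto)
  obtain a where "a \<in> A" using A_nonempty by blast
  have "\<exists>\<beta>. \<forall>i n. X i n = X_tilde K \<pi> A i n + ones i * \<beta> n"
    if "pi_abs_finite \<pi> (X_tilde K \<pi> A)" "poisson_solution K \<pi> X" "pi_abs_finite \<pi> X" for X
    \<comment> \<open>the difference of two solutions is constant along each column; its value is read off at \<open>a\<close>\<close>
  proof (intro exI allI)
    fix i n
    show "X i n = X_tilde K \<pi> A i n + ones i * (X a n - X_tilde K \<pi> A a n)"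
      using poisson_solution_unique[OF that(2,3) poisson_solution_X_tilde that(1), of i n a]
      by (simp add: ones_def)
  qed
  then show ?thesis
    using poisson_solution_X_tilde pi_abs_finite_X_tilde by blast
qed

end
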